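(* When the translation surface $M=M(\pi,\lambda,\tau)$ has no horizontal connection, the backward rotation number $\underline\gamma$ associated to $(\pi,\tau)$ is $\infty$-complete.
   Context: Let $\mathcal A$ be an alphabet with $d\ge2$ letters and $\pi=(\pi_t,\pi_b)$ an irreducible pair of bijections $\mathcal A\to\{1,\dots,d\}$ (irreducible: $\pi_t^{-1}(\{1,\dots,k\})\ne\pi_b^{-1}(\{1,\dots,k\})$ for $1\le k<d$). Let $\lambda\in(0,\infty)^{\mathcal A}$ and let $\tau\in\Theta_\pi$, i.e. $\sum_{\pi_t(\alpha)<k}\tau_\alpha>0$ and $\sum_{\pi_b(\alpha)<k}\tau_\alpha<0$ for all $1<k\le d$. Put $\zeta_\alpha=\lambda_\alpha+\sqrt{-1}\,\tau_\alpha$. $M(\pi,\lambda,\tau)$ is the translation surface given by Veech's zippered rectangle construction; when the broken lines with vertices $U_i=\sum_{\pi_t(\alpha)\le i}\zeta_\alpha$ and $V_i=\sum_{\pi_b(\alpha)\le i}\zeta_\alpha$ ($0\le i\le d$) meet only at their endpoints, it is the polygon bounded by them with the two sides $\zeta_\alpha$ identified by translation for each $\alpha$. The marked set $\Sigma$ is the image of the vertices. A horizontal connection is an orbit of the horizontal flow which starts and ends at points of $\Sigma$. Backward Rauzy--Veech algorithm (well defined when $M$ has no horizontal connection): starting from $(\pi^{(0)},\zeta^{(0)})=(\pi,\zeta)$, define $(\pi^{(n)},\zeta^{(n)}=\lambda^{(n)}+\sqrt{-1}\tau^{(n)})$ for $n\le0$. If $\sum_\alpha\tau_\alpha^{(n)}<0$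 (top type), let $\alpha_w,\alpha_\ell$ be the letters with $\pi_t^{(n)}(\alpha_w)=d$ and $\pi_b^{(n)}(\alpha_\ell)=\pi_b^{(n)}(\alpha_w)+1$; $\pi^{(n-1)}$ has the same top row, and its bottom row is obtained by moving $\alpha_\ell$ to the last place. If $\sum_\alpha\tau_\alpha^{(n)}>0$ (bottom type), let $\alpha_w,\alpha_\ell$ be the letters with $\pi_b^{(n)}(\alpha_w)=d$ and $\pi_t^{(n)}(\alpha_\ell)=\pi_t^{(n)}(\alpha_w)+1$; $\pi^{(n-1)}$ has the same bottom row, and its top row is obtained by moving $\alpha_\ell$ to the last place. In both cases $\zeta_{\alpha_w}^{(n-1)}=\zeta_{\alpha_w}^{(n)}+\zeta_{\alpha_\ell}^{(n)}$ and $\zeta_\alpha^{(n-1)}=\zeta_\alpha^{(n)}$ for $\alpha\ne\alpha_w$. The corresponding arrow $\gamma_n:\pi^{(n-1)}\to\pi^{(n)}$ has winner $\alpha_w$ and loser $\alpha_\ell$. The backward rotation number is the infinite path $\underline\gamma=\cdots\star\gamma_{n-1}\star\gamma_n\star\cdots\star\gamma_{-1}\star\gamma_0$ ending at $\pi$; it depends only on $(\pi,\tau)$. A finite path is complete if every letter of $\mathcal A$ is the winner of at least one of its arrows; an infinite path is $\infty$-complete if it is the concatenation of infinitely many finite complete paths. *)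

theory Defs
  imports Complex_Main "HOL-Library.Cardinality"
begin

section \<open>Combinatorial and suspension data\<close>

definition irreducible_pair :: "('a::finite \<Rightarrow> nat) \<Rightarrow> ('a \<Rightarrow> nat) \<Rightarrow> bool" where
  "irreducible_pair \<pi>t \<pi>b \<longleftrightarrow>
     bij_betw \<pi>t UNIV {1..CARD('a)} \<and> bij_betw \<pi>b UNIV {1..CARD('a)} \<and>
     (\<forall>k. 1 \<le> k \<and> k < CARD('a) \<longrightarrow> \<pi>t -` {1..k} \<noteq> \<pi>b -` {1..k})"

definition Theta :: "('a::finite \<Rightarrow> nat) \<Rightarrow> ('a \<Rightarrow> nat) \<Rightarrow> ('a \<Rightarrow> real) set" where
  "Theta \<pi>t \<pi>b = {\<tau>. \<forall>k. 1 < k \<and> k \<le> CARD('a) \<longrightarrow>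
     (\<Sum>\<alpha> | \<pi>t \<alpha> < k. \<tau> \<alpha>) > 0 \<and> (\<Sum>\<alpha> | \<pi>b \<alpha> < k. \<tau> \<alpha>) < 0}"

definition zeta :: "('a \<Rightarrow> real) \<Rightarrow> ('a \<Rightarrow> real) \<Rightarrow> 'a \<Rightarrow> complex" where
  "zeta lam \<tau> \<alpha> = Complex (lam \<alpha>) (\<tau> \<alpha>)"

text \<open>
  The vertices of the broken lines: \<open>U\<^sub>i = vertex \<pi>t \<zeta> i\<close> and \<open>V\<^sub>i = vertex \<pi>b \<zeta> i\<close>.
\<close>

definition vertex :: "('a::finite \<Rightarrow> nat) \<Rightarrow> ('a \<Rightarrow> complex) \<Rightarrow> nat \<Rightarrow> complex" where
  "vertex p \<zeta> i = (\<Sum>\<alpha> | p \<alpha> \<le> i. \<zeta> \<alpha>)"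


section \<open>The zippered rectangle surface\<close>

text \<open>
  The rectangle of the letter \<open>\<alpha>\<close> has width \<open>Re (\<zeta> \<alpha>)\<close> and the height \<open>height \<pi>t \<pi>b \<zeta> \<alpha>\<close>.
  The right end of the side \<open>\<zeta> \<alpha>\<close> is \<open>U\<^sub>i\<close> on the top line (\<open>i = \<pi>t \<alpha>\<close>) and \<open>V\<^sub>j\<close> on the
  bottom line (\<open>j = \<pi>b \<alpha>\<close>), so \<open>U\<^sub>i - V\<^sub>j\<close> is (up to sign) the translation which identifies
  the two copies of this side; the same difference results from the left ends
  \<open>U\<^bsub>i-1\<^esub>\<close> and \<open>V\<^bsub>j-1\<^esub>\<close>.
\<close>

definition height :: "('a::finite \<Rightarrow> nat) \<Rightarrow> ('a \<Rightarrow> nat) \<Rightarrow> ('a \<Rightarrow> complex) \<Rightarrow> 'a \<Rightarrow> real" where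
  "height \<pi>t \<pi>b \<zeta> \<alpha> = Im (vertex \<pi>t \<zeta> (\<pi>t \<alpha>)) - Im (vertex \<pi>b \<zeta> (\<pi>b \<alpha>))"

text \<open>
  A point \<open>(\<alpha>, x, y)\<close> lies in the closed rectangle of \<open>\<alpha>\<close>, with \<open>x\<close> and \<open>y\<close> measured from its
  lower left corner.
\<close>

definition rectangles ::
  "('a::finite \<Rightarrow> nat) \<Rightarrow> ('a \<Rightarrow> nat) \<Rightarrow> ('a \<Rightarrow> complex) \<Rightarrow> ('a \<times> real \<times> real) set" where
  "rectangles \<pi>t \<pi>b \<zeta> =
     {(\<alpha>, x, y). 0 \<le> x \<and> x \<le> Re (\<zeta> \<alpha>) \<and> 0 \<le> y \<and> y \<le> height \<pi>t \<pi>b \<zeta> \<alpha>}"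

text \<open>
  The bases of the rectangles partition the horizontal segment \<open>[0, \<Sum>\<alpha>. Re (\<zeta> \<alpha>)]\<close> in the
  order \<open>\<pi>t\<close>, and their tops are glued to this segment in the order \<open>\<pi>b\<close> (rule \<open>base\<close>).
  Vertical sides: rectangles which are neighbours in the order \<open>\<pi>t\<close> are zipped together above the
  segment, from height 0 up to the vertex \<open>U\<^sub>i\<close> (rule \<open>zip_top\<close>); rectangles which are
  neighbours in the order \<open>\<pi>b\<close> hang below the segment and are zipped together from their tops down
  to the vertex \<open>V\<^sub>j\<close> (rule \<open>zip_bot\<close>).

  One zipper can be longer than the rectangle on its left; the excess is then glued to the vertical
  segment between the right end point of the base segment and the last vertex \<open>U\<^sub>d = V\<^sub>d\<close>.
  If \<open>\<Sum>\<alpha>. Im (\<zeta> \<alpha>) > 0\<close>, it is the top zipper to the right of the last rectangle \<open>\<beta>\<close> of the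
  bottom row (rule \<open>end_top\<close>); if \<open>\<Sum>\<alpha>. Im (\<zeta> \<alpha>) < 0\<close>, it is the bottom zipper to the right of
  the last rectangle \<open>\<alpha>\<close> of the top row (rule \<open>end_bot\<close>).
\<close>

inductive glue ::
  "('a::finite \<Rightarrow> nat) \<Rightarrow> ('a \<Rightarrow> nat) \<Rightarrow> ('a \<Rightarrow> complex) \<Rightarrow>
     'a \<times> real \<times> real \<Rightarrow> 'a \<times> real \<times> real \<Rightarrow> bool"
  for \<pi>t \<pi>b :: "'a::finite \<Rightarrow> nat" and \<zeta> :: "'a \<Rightarrow> complex" where
  base:
    "\<lbrakk>0 \<le> x; x \<le> Re (\<zeta> \<alpha>); 0 \<le> x'; x' \<le> Re (\<zeta> \<alpha>');
      Re (vertex \<pi>b \<zeta> (\<pi>b \<alpha> - 1)) + x = Re (vertex \<pi>t \<zeta> (\<pi>t \<alpha>' - 1)) + x'\<rbrakk>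
     \<Longrightarrow> glue \<pi>t \<pi>b \<zeta> (\<alpha>, x, height \<pi>t \<pi>b \<zeta> \<alpha>) (\<alpha>', x', 0)"
| zip_top:
    "\<lbrakk>\<pi>t \<alpha>' = \<pi>t \<alpha> + 1; 0 \<le> y; y \<le> Im (vertex \<pi>t \<zeta> (\<pi>t \<alpha>)); y \<le> height \<pi>t \<pi>b \<zeta> \<alpha>\<rbrakk>
     \<Longrightarrow> glue \<pi>t \<pi>b \<zeta> (\<alpha>, Re (\<zeta> \<alpha>), y) (\<alpha>', 0, y)"
| zip_bot:
    "\<lbrakk>\<pi>b \<alpha>' = \<pi>b \<alpha> + 1; 0 \<le> s; s \<le> - Im (vertex \<pi>b \<zeta> (\<pi>b \<alpha>)); s \<le> height \<pi>t \<pi>b \<zeta> \<alpha>\<rbrakk>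
     \<Longrightarrow> glue \<pi>t \<pi>b \<zeta> (\<alpha>, Re (\<zeta> \<alpha>), height \<pi>t \<pi>b \<zeta> \<alpha> - s) (\<alpha>', 0, height \<pi>t \<pi>b \<zeta> \<alpha>' - s)"
| end_top:
    "\<lbrakk>\<pi>t \<alpha> = CARD('a); \<pi>b \<beta> = CARD('a); \<pi>t \<beta>' = \<pi>t \<beta> + 1;
      0 \<le> y; y \<le> (\<Sum>\<delta>\<in>UNIV. Im (\<zeta> \<delta>)); (\<Sum>\<delta>\<in>UNIV. Im (\<zeta> \<delta>)) > 0\<rbrakk>
     \<Longrightarrow> glue \<pi>t \<pi>b \<zeta> (\<alpha>, Re (\<zeta> \<alpha>), y) (\<beta>', 0, height \<pi>t \<pi>b \<zeta> \<beta> + y)"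
| end_bot:
    "\<lbrakk>\<pi>t \<alpha> = CARD('a); \<pi>b \<beta> = CARD('a); \<pi>b \<alpha>' = \<pi>b \<alpha> + 1;
      0 \<le> s; s \<le> - (\<Sum>\<delta>\<in>UNIV. Im (\<zeta> \<delta>)); (\<Sum>\<delta>\<in>UNIV. Im (\<zeta> \<delta>)) < 0\<rbrakk>
     \<Longrightarrow> glue \<pi>t \<pi>b \<zeta> (\<beta>, Re (\<zeta> \<beta>), height \<pi>t \<pi>b \<zeta> \<beta> - s)
           (\<alpha>', 0, height \<pi>t \<pi>b \<zeta> \<alpha>' - height \<pi>t \<pi>b \<zeta> \<alpha> - s)"

definition glue_rel ::
  "('a::finite \<Rightarrow> nat) \<Rightarrow> ('a \<Rightarrow> nat) \<Rightarrow> ('a \<Rightarrow> complex) \<Rightarrow>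
     (('a \<times> real \<times> real) \<times> ('a \<times> real \<times> real)) set" where
  "glue_rel \<pi>t \<pi>b \<zeta> = {(p, q). p \<in> rectangles \<pi>t \<pi>b \<zeta> \<and> q \<in> rectangles \<pi>t \<pi>b \<zeta> \<and>
     equivclp (glue \<pi>t \<pi>b \<zeta>) p q}"

lemma equiv_glue_rel: "equiv (rectangles \<pi>t \<pi>b \<zeta>) (glue_rel \<pi>t \<pi>b \<zeta>)"
  by (rule equivI)
    (auto simp: glue_rel_def refl_on_def intro!: symI transI intro: equivclp_sym equivclp_trans)

definition surface ::
  "('a::finite \<Rightarrow> nat) \<Rightarrow> ('a \<Rightarrow> nat) \<Rightarrow> ('a \<Rightarrow> complex) \<Rightarrow> ('a \<times> real \<times> real) set set" where
  "surface \<pi>t \<pi>b \<zeta> = rectangles \<pi>t \<pi>b \<zeta> // glue_rel \<pi>t \<pi>b \<zeta>"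

abbreviation surface_pt ::
  "('a::finite \<Rightarrow> nat) \<Rightarrow> ('a \<Rightarrow> nat) \<Rightarrow> ('a \<Rightarrow> complex) \<Rightarrow>
     'a \<times> real \<times> real \<Rightarrow> ('a \<times> real \<times> real) set" where
  "surface_pt \<pi>t \<pi>b \<zeta> p \<equiv> glue_rel \<pi>t \<pi>b \<zeta> `` {p}"

text \<open>
  The image of the vertices.  The vertex \<open>U\<^bsub>\<pi>t \<alpha> - 1\<^esub>\<close> always lies on the left side of the
  rectangle of \<open>\<alpha>\<close>; the vertex \<open>U\<^bsub>\<pi>t \<alpha>\<^esub>\<close> lies on its right side unless it is above the top or
  below the base.  By the definition of \<open>height\<close> these are also the images of the \<open>V\<^sub>j\<close>.
\<close>

definition marked ::
  "('a::finite \<Rightarrow> nat) \<Rightarrow> ('a \<Rightarrow> nat) \<Rightarrow> ('a \<Rightarrow> complex) \<Rightarrow> ('a \<times> real \<times> real) set set" where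
  "marked \<pi>t \<pi>b \<zeta> = surface_pt \<pi>t \<pi>b \<zeta> `
     (rectangles \<pi>t \<pi>b \<zeta> \<inter>
       (range (\<lambda>\<alpha>. (\<alpha>, 0, Im (vertex \<pi>t \<zeta> (\<pi>t \<alpha> - 1)))) \<union>
        range (\<lambda>\<alpha>. (\<alpha>, Re (\<zeta> \<alpha>), Im (vertex \<pi>t \<zeta> (\<pi>t \<alpha>))))))"

text \<open>
  An orbit segment of the horizontal flow over the time interval \<open>[0, L]\<close>: immediately after and
  immediately before each time it moves to the right, at unit speed and constant height, in one of
  the closed rectangles.  Away from the marked points this determines the orbit by its initial point.
\<close>

definition horizontal_orbit ::
  "('a::finite \<Rightarrow> nat) \<Rightarrow> ('a \<Rightarrow> nat) \<Rightarrow> ('a \<Rightarrow> complex) \<Rightarrow>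
     real \<Rightarrow> (real \<Rightarrow> ('a \<times> real \<times> real) set) \<Rightarrow> bool" where
  "horizontal_orbit \<pi>t \<pi>b \<zeta> L c \<longleftrightarrow>
     (\<forall>t\<in>{0..L}. c t \<in> surface \<pi>t \<pi>b \<zeta>) \<and>
     (\<forall>t\<in>{0..<L}. \<exists>\<epsilon>>0. \<exists>\<alpha> x y. t + \<epsilon> \<le> L \<and>
        (\<forall>s\<in>{0..\<epsilon>}. (\<alpha>, x + s, y) \<in> rectangles \<pi>t \<pi>b \<zeta> \<and>
           c (t + s) = surface_pt \<pi>t \<pi>b \<zeta> (\<alpha>, x + s, y))) \<and>
     (\<forall>t\<in>{0<..L}. \<exists>\<epsilon>>0. \<exists>\<alpha> x y. 0 \<le> t - \<epsilon> \<and>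
        (\<forall>s\<in>{0..\<epsilon>}. (\<alpha>, x - s, y) \<in> rectangles \<pi>t \<pi>b \<zeta> \<and>
           c (t - s) = surface_pt \<pi>t \<pi>b \<zeta> (\<alpha>, x - s, y)))"

definition has_horizontal_connection ::
  "('a::finite \<Rightarrow> nat) \<Rightarrow> ('a \<Rightarrow> nat) \<Rightarrow> ('a \<Rightarrow> complex) \<Rightarrow> bool" where
  "has_horizontal_connection \<pi>t \<pi>b \<zeta> \<longleftrightarrow>
     (\<exists>L>0. \<exists>c. horizontal_orbit \<pi>t \<pi>b \<zeta> L c \<and>
        c 0 \<in> marked \<pi>t \<pi>b \<zeta> \<and> c L \<in> marked \<pi>t \<pi>b \<zeta> \<and>
        (\<forall>t\<in>{0<..<L}. c t \<notin> marked \<pi>t \<pi>b \<zeta>))"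


section \<open>The backward Rauzy--Veech algorithm\<close>

type_synonym 'a rv_state = "('a \<Rightarrow> nat) \<times> ('a \<Rightarrow> nat) \<times> ('a \<Rightarrow> complex)"

definition letter :: "('a \<Rightarrow> nat) \<Rightarrow> nat \<Rightarrow> 'a" where
  "letter p k = (THE \<alpha>. p \<alpha> = k)"

definition move_last :: "'a::finite \<Rightarrow> ('a \<Rightarrow> nat) \<Rightarrow> 'a \<Rightarrow> nat" where
  "move_last l p \<alpha> =
     (if \<alpha> = l then CARD('a) else if p \<alpha> > p l then p \<alpha> - 1 else p \<alpha>)"

record 'a arrow =
  source :: "('a \<Rightarrow> nat) \<times> ('a \<Rightarrow> nat)"
  target :: "('a \<Rightarrow> nat) \<times> ('a \<Rightarrow> nat)"
  winner :: 'a
  loser :: 'a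

text \<open>
  One backward step yields the arrow \<open>\<gamma>\<^sub>n\<close> from \<open>\<pi>\<^bsup>(n-1)\<^esup>\<close> to \<open>\<pi>\<^bsup>(n)\<^esup>\<close> together with the new
  data.  It is undefined if \<open>\<Sum>\<alpha>. \<tau>\<^sub>\<alpha> = 0\<close>.
\<close>

fun backward_step :: "'a::finite rv_state \<Rightarrow> ('a arrow \<times> 'a rv_state) option" where
  "backward_step (\<pi>t, \<pi>b, \<zeta>) =
     (if (\<Sum>\<alpha>\<in>UNIV. Im (\<zeta> \<alpha>)) < 0 then
        (let w = letter \<pi>t CARD('a); l = letter \<pi>b (\<pi>b w + 1); \<pi>b' = move_last l \<pi>b in
         Some (\<lparr>source = (\<pi>t, \<pi>b'), target = (\<pi>t, \<pi>b), winner = w, loser = l\<rparr>,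
               (\<pi>t, \<pi>b', \<zeta>(w := \<zeta> w + \<zeta> l))))
      else if (\<Sum>\<alpha>\<in>UNIV. Im (\<zeta> \<alpha>)) > 0 then
        (let w = letter \<pi>b CARD('a); l = letter \<pi>t (\<pi>t w + 1); \<pi>t' = move_last l \<pi>t in
         Some (\<lparr>source = (\<pi>t', \<pi>b), target = (\<pi>t, \<pi>b), winner = w, loser = l\<rparr>,
               (\<pi>t', \<pi>b, \<zeta>(w := \<zeta> w + \<zeta> l))))
      else None)"

text \<open>
  Paths which are infinite to the left are indexed by \<open>nat\<close>: \<open>\<gamma> m\<close> is the arrow \<open>\<gamma>\<^bsub>-m\<^esub>\<close>.
  The predicate implies that no step of the algorithm is undefined.
\<close>

definition backward_rotation_number ::
  "('a::finite \<Rightarrow> nat) \<Rightarrow> ('a \<Rightarrow> nat) \<Rightarrow> ('a \<Rightarrow> complex) \<Rightarrow> (nat \<Rightarrow> 'a arrow) \<Rightarrow> bool" where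
  "backward_rotation_number \<pi>t \<pi>b \<zeta> \<gamma> \<longleftrightarrow>
     (\<exists>S. S 0 = (\<pi>t, \<pi>b, \<zeta>) \<and> (\<forall>m. backward_step (S m) = Some (\<gamma> m, S (Suc m))))"

lemma backward_rotation_number_unique:
  assumes "backward_rotation_number \<pi>t \<pi>b \<zeta> \<gamma>" and "backward_rotation_number \<pi>t \<pi>b \<zeta> \<gamma>'"
  shows "\<gamma> = \<gamma>'"
proof -
  obtain S where S: "S 0 = (\<pi>t, \<pi>b, \<zeta>)" "\<And>m. backward_step (S m) = Some (\<gamma> m, S (Suc m))"
    using assms(1) by (auto simp: backward_rotation_number_def)
  obtain S' where S': "S' 0 = (\<pi>t, \<pi>b, \<zeta>)" "\<And>m. backward_step (S' m) = Some (\<gamma>' m, S' (Suc m))"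
    using assms(2) by (auto simp: backward_rotation_number_def)
  have "S m = S' m" for m
  proof (induction m)
    case (Suc m)
    show ?case using S(2)[of m] S'(2)[of m] Suc by simp
  qed (simp add: S S')
  then show ?thesis using S(2) S'(2) by (auto simp: fun_eq_iff)
qed

definition complete_path :: "'a arrow list \<Rightarrow> bool" where
  "complete_path p \<longleftrightarrow> (\<forall>\<alpha>. \<exists>a\<in>set p. winner a = \<alpha>)"

text \<open>
  The \<open>j\<close>-th block is the path \<open>\<gamma>\<^bsub>-(k (j+1) - 1)\<^esub> \<star> \<dots> \<star> \<gamma>\<^bsub>-k j\<^esub>\<close>; the blocks are
  counted from right to left.
\<close>

definition infinitely_complete :: "(nat \<Rightarrow> 'a arrow) \<Rightarrow> bool" where
  "infinitely_complete \<gamma> \<longleftrightarrow>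
     (\<exists>k :: nat \<Rightarrow> nat. k 0 = 0 \<and> strict_mono k \<and>
        (\<forall>j. complete_path (map \<gamma> (rev [k j..<k (Suc j)]))))"

end

theory Submission imports Defs begin

text \<open>
  A backward step with winner \<open>w\<close> and loser \<open>l\<close> replaces \<open>\<zeta>\<^sub>w\<close> by
  \<open>\<zeta>\<^sub>w + \<zeta>\<^sub>l\<close> and the height \<open>h\<^sub>l\<close> of the loser's rectangle by
  \<open>h\<^sub>l - h\<^sub>w\<close>, and it leaves the other vectors and heights alone.  All heights stay
  positive, so the height of a letter that wins infinitely often tends to \<open>0\<close>
  (\<open>frequent_winner_vanishes\<close>).

  Let \<open>C\<close> be the set of the letters that win only finitely often, and suppose that it is not empty.
  From some step on the vectors \<open>\<zeta>\<^sub>\<alpha>\<close> with \<open>\<alpha> \<in> C\<close> are constant, so there is \<open>\<epsilon> > 0\<close> such that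
  every sum of \<open>\<tau>\<close> over a subset of \<open>C\<close> either vanishes or has absolute value at least \<open>\<epsilon>\<close>.
  Still later, all letters outside \<open>C\<close> have height less than \<open>\<epsilon>\<close>.  Consider a maximal block of
  letters of \<open>C\<close> in the top row at a step of top type.  The vertices at its two ends are less
  than \<open>\<epsilon>\<close> above the base: such a vertex is \<open>U\<^sub>0\<close> or the end of a zipper along a rectangle of
  height less than \<open>\<epsilon>\<close>.  The sum of \<open>\<tau>\<close> over the block is the difference of their heights, so it
  vanishes.  In the same way, no vertex between them is lower.  So the horizontal segment that joins
  them runs through the rectangles of the block and contains a connection of the current
  surface (\<open>small_heights_connection\<close>).

  This contradicts the hypothesis because consecutive surfaces are obtained from each other by
  cutting and pasting: a connection after a step of top type is a connection before it
  (\<open>top_step_connection\<close>, by the map \<open>unpaste\<close> and the criterion \<open>connection_transfer\<close>), and the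
  reflection in the real axis (\<open>swap_connection\<close>) reduces bottom type to top type.  The same argument
  shows that the algorithm never stops: if the sum of all \<open>\<tau>\<^sub>\<alpha>\<close> vanishes at some step,
  the base segment is a connection.

  Working on the glued surface requires recognizing the marked points.  A coordinate
  description of the vertices in the rectangles is invariant under each gluing rule, and this yields a
  criterion without equivalence classes (\<open>marked_iff\<close>).
\<close>


section \<open>Broken lines\<close>

lemma position_bounds:
  fixes p :: "'a::finite \<Rightarrow> nat"
  assumes "bij_betw p UNIV {1..CARD('a)}"
  shows "1 \<le> p \<alpha>" and "p \<alpha> \<le> CARD('a)"
  using bij_betwE[OF assms] by auto

lemma position_eq_iff:
  fixes p :: "'a::finite \<Rightarrow> nat"
  assumes "bij_betw p UNIV {1..CARD('a)}"
  shows "p \<alpha> = p \<beta> \<longleftrightarrow> \<alpha> = \<beta>"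
  using bij_betw_imp_inj_on[OF assms] by (auto dest: injD)

lemma letter_at:
  fixes p :: "'a::finite \<Rightarrow> nat"
  assumes "bij_betw p UNIV {1..CARD('a)}" "1 \<le> k" "k \<le> CARD('a)"
  shows "p (letter p k) = k"
proof -
  have "k \<in> p ` UNIV" using assms by (simp add: bij_betw_def)
  then obtain \<alpha> where "p \<alpha> = k" by auto
  then show ?thesis unfolding letter_def
    using position_eq_iff[OF assms(1)] by (metis (mono_tags, lifting) theI)
qed

lemma vertex_0:
  fixes p :: "'a::finite \<Rightarrow> nat"
  assumes "bij_betw p UNIV {1..CARD('a)}"
  shows "vertex p \<zeta> 0 = 0"
proof -
  have "{\<alpha>. p \<alpha> \<le> 0} = {}" using position_bounds(1)[OF assms] by (auto simp: not_le Suc_le_eq)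
  then show ?thesis by (simp only: vertex_def) simp
qed

lemma vertex_last:
  fixes p :: "'a::finite \<Rightarrow> nat"
  assumes "bij_betw p UNIV {1..CARD('a)}"
  shows "vertex p \<zeta> CARD('a) = (\<Sum>\<alpha>\<in>UNIV. \<zeta> \<alpha>)"
  using position_bounds(2)[OF assms] by (simp add: vertex_def)

lemma vertex_step:
  fixes p :: "'a::finite \<Rightarrow> nat"
  assumes "bij_betw p UNIV {1..CARD('a)}"
  shows "vertex p \<zeta> (p \<alpha>) = vertex p \<zeta> (p \<alpha> - 1) + \<zeta> \<alpha>"
proof -
  have "{\<beta>. p \<beta> \<le> p \<alpha>} = insert \<alpha> {\<beta>. p \<beta> \<le> p \<alpha> - 1}"
    using position_eq_iff[OF assms] position_bounds(1)[OF assms, of \<alpha>]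
    by (auto, metis Suc_pred' le_SucE not_less_eq_eq less_eq_Suc_le One_nat_def)
  moreover have "\<alpha> \<notin> {\<beta>. p \<beta> \<le> p \<alpha> - 1}"
    using position_bounds(1)[OF assms, of \<alpha>] by auto
  ultimately show ?thesis by (simp add: vertex_def add.commute)
qed

lemma vertex_diff:
  fixes p :: "'a::finite \<Rightarrow> nat"
  assumes "m \<le> k"
  shows "vertex p \<zeta> k - vertex p \<zeta> m = (\<Sum>\<alpha> | m < p \<alpha> \<and> p \<alpha> \<le> k. \<zeta> \<alpha>)"
proof -
  have "{\<alpha>. p \<alpha> \<le> k} = {\<alpha>. p \<alpha> \<le> m} \<union> {\<alpha>. m < p \<alpha> \<and> p \<alpha> \<le> k}" using assms by auto
  then have "vertex p \<zeta> k = vertex p \<zeta> m + (\<Sum>\<alpha> | m < p \<alpha> \<and> p \<alpha> \<le> k. \<zeta> \<alpha>)"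
    unfolding vertex_def by (simp only:, subst sum.union_disjoint) auto
  then show ?thesis by simp
qed

lemma vertex_Re_mono:
  fixes p :: "'a::finite \<Rightarrow> nat"
  assumes "\<And>\<alpha>. 0 < Re (\<zeta> \<alpha>)" "m \<le> k"
  shows "Re (vertex p \<zeta> m) \<le> Re (vertex p \<zeta> k)"
proof -
  have "Re (vertex p \<zeta> k - vertex p \<zeta> m) \<ge> 0"
    unfolding vertex_diff[OF assms(2)] using assms(1) by (simp add: sum_nonneg less_imp_le)
  then show ?thesis by simp
qed

lemma vertex_Re_less:
  fixes p :: "'a::finite \<Rightarrow> nat"
  assumes "bij_betw p UNIV {1..CARD('a)}" "\<And>\<alpha>. 0 < Re (\<zeta> \<alpha>)" "m < k" "k \<le> CARD('a)"
  shows "Re (vertex p \<zeta> m) < Re (vertex p \<zeta> k)"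
proof -
  let ?a = "letter p k"
  have pk: "p ?a = k" using letter_at[OF assms(1)] assms(3,4) by simp
  have "Re (vertex p \<zeta> m) \<le> Re (vertex p \<zeta> (k - 1))"
    using vertex_Re_mono[where \<zeta> = \<zeta>, OF assms(2)] assms(3) by simp
  then show ?thesis using vertex_step[OF assms(1), of \<zeta> ?a] pk assms(2)[of ?a] by simp
qed

lemma vertex_cnj: "vertex p (cnj \<circ> \<zeta>) k = cnj (vertex p \<zeta> k)"
  by (simp add: vertex_def)


section \<open>Suspension data and the marked points\<close>

text \<open>
  For bijections the inequalities of \<open>\<Theta>\<close> force irreducibility: a common initial block of the
  two rows would have the same sum of \<open>\<tau>\<close> in both.  So it is these inequalities that
  are carried along the backward steps.
\<close>

locale suspension =
  fixes \<pi>t \<pi>b :: "'a::finite \<Rightarrow> nat" and \<zeta> :: "'a \<Rightarrow> complex"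
  assumes two_letters: "2 \<le> CARD('a)"
    and top_bij: "bij_betw \<pi>t UNIV {1..CARD('a)}"
    and bot_bij: "bij_betw \<pi>b UNIV {1..CARD('a)}"
    and width_pos: "\<And>\<alpha>. 0 < Re (\<zeta> \<alpha>)"
    and top_pos: "\<And>k. 1 \<le> k \<Longrightarrow> k < CARD('a) \<Longrightarrow> 0 < Im (vertex \<pi>t \<zeta> k)"
    and bot_neg: "\<And>k. 1 \<le> k \<Longrightarrow> k < CARD('a) \<Longrightarrow> Im (vertex \<pi>b \<zeta> k) < 0"
begin

abbreviation "U \<equiv> vertex \<pi>t \<zeta>"
abbreviation "V \<equiv> vertex \<pi>b \<zeta>"
abbreviation "h \<equiv> height \<pi>t \<pi>b \<zeta>"
abbreviation "Z \<equiv> \<Sum>\<alpha>\<in>UNIV. \<zeta> \<alpha>"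

lemmas top_bounds = position_bounds[OF top_bij]
lemmas bot_bounds = position_bounds[OF bot_bij]
lemmas top_eq_iff = position_eq_iff[OF top_bij]
lemmas bot_eq_iff = position_eq_iff[OF bot_bij]
lemmas U_0 = vertex_0[OF top_bij, of \<zeta>]
lemmas V_0 = vertex_0[OF bot_bij, of \<zeta>]
lemmas U_last = vertex_last[OF top_bij, of \<zeta>]
lemmas V_last = vertex_last[OF bot_bij, of \<zeta>]
lemmas U_step = vertex_step[OF top_bij, of \<zeta>]
lemmas V_step = vertex_step[OF bot_bij, of \<zeta>]

lemma U_nonneg: "k < CARD('a) \<Longrightarrow> 0 \<le> Im (U k)"
  using top_pos[of k] U_0 by (cases "k = 0") auto

lemma V_nonpos: "k < CARD('a) \<Longrightarrow> Im (V k) \<le> 0"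
  using bot_neg[of k] V_0 by (cases "k = 0") auto

lemma height_left: "h \<alpha> = Im (U (\<pi>t \<alpha> - 1)) - Im (V (\<pi>b \<alpha> - 1))"
  by (simp add: height_def U_step V_step)

lemma height_pos: "0 < h \<alpha>"
proof (cases "\<pi>t \<alpha> = CARD('a)")
  case True
  then have "0 < Im (U (\<pi>t \<alpha> - 1))" using top_pos two_letters by simp
  moreover have "Im (V (\<pi>b \<alpha> - 1)) \<le> 0"
    using V_nonpos bot_bounds[of \<alpha>] by simp
  ultimately show ?thesis by (simp add: height_left)
next
  case top: False
  then have U: "0 < Im (U (\<pi>t \<alpha>))" "0 \<le> Im (U (\<pi>t \<alpha> - 1))"
    using top_pos U_nonneg top_bounds[of \<alpha>] by auto
  show ?thesis
  proof (cases "\<pi>b \<alpha> = CARD('a)")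
    case True
    then have "Im (V (\<pi>b \<alpha> - 1)) < 0" using bot_neg two_letters by simp
    then show ?thesis using U by (simp add: height_left)
  next
    case False
    then have "Im (V (\<pi>b \<alpha>)) < 0" using bot_neg bot_bounds[of \<alpha>] by simp
    then show ?thesis using U by (simp add: height_def)
  qed
qed

text \<open>
  Reflecting the polygon in the real axis exchanges its two broken lines.  This reduces every
  statement about steps of bottom type to steps of top type.
\<close>

lemma swap: "suspension \<pi>b \<pi>t (cnj \<circ> \<zeta>)"
  by unfold_locales
    (use two_letters top_bij bot_bij width_pos top_pos bot_neg in \<open>auto simp: vertex_cnj\<close>)

end

text \<open>
  A description of the marked points by coordinates in the rectangles.  Unlike membership in a
  gluing class it can be evaluated directly, and it is constant on these classes.
\<close>

definition vertex_point :: "('a::finite \<Rightarrow> nat) \<Rightarrow> ('a \<Rightarrow> complex) \<Rightarrow> 'a \<times> real \<times> real \<Rightarrow> bool" where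
  "vertex_point \<pi>t \<zeta> = (\<lambda>(\<alpha>, x, y). x = 0 \<and> y = Im (vertex \<pi>t \<zeta> (\<pi>t \<alpha> - 1)) \<or>
     x = Re (\<zeta> \<alpha>) \<and> y = Im (vertex \<pi>t \<zeta> (\<pi>t \<alpha>)))"

lemma vertex_pointI_left: "y = Im (vertex \<pi>t \<zeta> (\<pi>t \<alpha> - 1)) \<Longrightarrow> vertex_point \<pi>t \<zeta> (\<alpha>, 0, y)"
  and vertex_pointI_right: "y = Im (vertex \<pi>t \<zeta> (\<pi>t \<alpha>)) \<Longrightarrow> vertex_point \<pi>t \<zeta> (\<alpha>, Re (\<zeta> \<alpha>), y)"
  by (auto simp: vertex_point_def)

context suspension
begin

text \<open>
  Here \<open>p\<close> stands for either row.  In both, the ends of the base segment are reached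
  only in the corners of the first and of the last rectangle.
\<close>

lemma base_position:
  assumes "bij_betw p UNIV {1..CARD('a)}" "0 \<le> x" "x \<le> Re (\<zeta> \<alpha>)"
  shows "Re (vertex p \<zeta> (p \<alpha> - 1)) + x = 0 \<longleftrightarrow> p \<alpha> = 1 \<and> x = 0"
    and "Re (vertex p \<zeta> (p \<alpha> - 1)) + x = Re Z \<longleftrightarrow> p \<alpha> = CARD('a) \<and> x = Re (\<zeta> \<alpha>)"
    and "Re (vertex p \<zeta> (p \<alpha> - 1)) + x \<le> Re Z"
proof -
  note b = position_bounds[OF assms(1), of \<alpha>] and st = vertex_step[OF assms(1), of \<zeta> \<alpha>]
  note less = vertex_Re_less[where \<zeta> = \<zeta>, OF assms(1) width_pos]
    and mono = vertex_Re_mono[where p = p and \<zeta> = \<zeta>, OF width_pos]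
  note ends = vertex_0[OF assms(1), of \<zeta>] vertex_last[OF assms(1), of \<zeta>]
  show "Re (vertex p \<zeta> (p \<alpha> - 1)) + x = 0 \<longleftrightarrow> p \<alpha> = 1 \<and> x = 0"
  proof (cases "p \<alpha> = 1")
    case False
    then show ?thesis using less[of 0 "p \<alpha> - 1"] b assms(2) ends by force
  qed (use ends in simp)
  have "Re (vertex p \<zeta> (p \<alpha>)) \<le> Re Z" using mono[of "p \<alpha>" "CARD('a)"] b ends by simp
  then show "Re (vertex p \<zeta> (p \<alpha> - 1)) + x \<le> Re Z" using st assms by simp
  show "Re (vertex p \<zeta> (p \<alpha> - 1)) + x = Re Z \<longleftrightarrow> p \<alpha> = CARD('a) \<and> x = Re (\<zeta> \<alpha>)"
  proof (cases "p \<alpha> = CARD('a)")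
    case True
    then have "vertex p \<zeta> (p \<alpha>) = Z" using ends by simp
    then show ?thesis using st True by auto
  next
    case False
    then show ?thesis using less[of "p \<alpha>" "CARD('a)"] b st assms ends by auto
  qed
qed

text \<open>
  A zipper ends at a vertex and contains no other one, on either of its two sides.  The base segment
  contains no vertex except \<open>U\<^sub>0\<close> at its left end and, if \<open>\<Sum>\<alpha>. Im (\<zeta> \<alpha>) = 0\<close>,
  \<open>U\<^sub>d\<close> at its right end.
\<close>

lemma glue_vertex_point:
  assumes "glue \<pi>t \<pi>b \<zeta> p q"
  shows "vertex_point \<pi>t \<zeta> p \<longleftrightarrow> vertex_point \<pi>t \<zeta> q"
  using assms
proof cases
  case (base x \<alpha> x' \<alpha>')
  have "vertex_point \<pi>t \<zeta> (\<alpha>, x, h \<alpha>) \<longleftrightarrow>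
      x = 0 \<and> Im (V (\<pi>b \<alpha> - 1)) = 0 \<or> x = Re (\<zeta> \<alpha>) \<and> Im (V (\<pi>b \<alpha>)) = 0"
  proof -
    have "h \<alpha> = Im (U (\<pi>t \<alpha> - 1)) \<longleftrightarrow> Im (V (\<pi>b \<alpha> - 1)) = 0"
      unfolding height_left by simp
    moreover have "h \<alpha> = Im (U (\<pi>t \<alpha>)) \<longleftrightarrow> Im (V (\<pi>b \<alpha>)) = 0"
      unfolding height_def by simp
    ultimately show ?thesis by (simp add: vertex_point_def)
  qed
  also have "Im (V (\<pi>b \<alpha> - 1)) = 0 \<longleftrightarrow> \<pi>b \<alpha> = 1"
    using bot_neg[of "\<pi>b \<alpha> - 1"] V_0 bot_bounds[of \<alpha>] by fastforce
  also have "Im (V (\<pi>b \<alpha>)) = 0 \<longleftrightarrow> \<pi>b \<alpha> = CARD('a) \<and> Im Z = 0"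
    using bot_neg[of "\<pi>b \<alpha>"] V_last bot_bounds[of \<alpha>] by fastforce
  finally have 1: "vertex_point \<pi>t \<zeta> (\<alpha>, x, h \<alpha>) \<longleftrightarrow>
    Re (V (\<pi>b \<alpha> - 1)) + x = 0 \<or> Re (V (\<pi>b \<alpha> - 1)) + x = Re Z \<and> Im Z = 0"
    using base_position[OF bot_bij base(3,4)] by auto
  have "Im (U (\<pi>t \<alpha>' - 1)) = 0 \<longleftrightarrow> \<pi>t \<alpha>' = 1"
    using top_pos[of "\<pi>t \<alpha>' - 1"] U_0 top_bounds[of \<alpha>'] by fastforce
  moreover have "Im (U (\<pi>t \<alpha>')) = 0 \<longleftrightarrow> \<pi>t \<alpha>' = CARD('a) \<and> Im Z = 0"
    using top_pos[of "\<pi>t \<alpha>'"] U_last top_bounds[of \<alpha>'] by fastforce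
  ultimately have 2: "vertex_point \<pi>t \<zeta> (\<alpha>', x', 0) \<longleftrightarrow>
    Re (U (\<pi>t \<alpha>' - 1)) + x' = 0 \<or> Re (U (\<pi>t \<alpha>' - 1)) + x' = Re Z \<and> Im Z = 0"
    using base_position[OF top_bij base(5,6)] by (auto simp: vertex_point_def)
  show ?thesis using 1 2 base by simp
next
  case (zip_top \<alpha>' \<alpha> y)
  then show ?thesis using width_pos[of \<alpha>] width_pos[of \<alpha>'] by (simp add: vertex_point_def)
next
  case (zip_bot \<alpha>' \<alpha> s)
  have "h \<alpha> - s = Im (U (\<pi>t \<alpha>)) \<longleftrightarrow> h \<alpha>' - s = Im (U (\<pi>t \<alpha>' - 1))"
    using zip_bot(3) by (auto simp: height_left[of \<alpha>'] height_def[of _ _ _ \<alpha>])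
  then show ?thesis using zip_bot width_pos[of \<alpha>] width_pos[of \<alpha>']
    by (simp add: vertex_point_def)
next
  case (end_top \<alpha> \<beta> \<beta>' y)
  have "Im (U (\<pi>t \<alpha>)) = Im (U (\<pi>t \<beta>)) - h \<beta>"
    using end_top(3,4) by (simp add: height_def U_last V_last)
  then show ?thesis using end_top width_pos[of \<alpha>] width_pos[of \<beta>']
    by (auto simp: vertex_point_def)
next
  case (end_bot \<alpha> \<beta> \<alpha>' s)
  have "h \<beta> - s = Im (U (\<pi>t \<beta>)) \<longleftrightarrow> h \<alpha>' - h \<alpha> - s = Im (U (\<pi>t \<alpha>' - 1))"
    using end_bot(3-5) by (auto simp: height_left[of \<alpha>'] height_def[of _ _ _ \<alpha>]
        height_def[of _ _ _ \<beta>] U_last V_last)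
  then show ?thesis using end_bot width_pos[of \<beta>] width_pos[of \<alpha>']
    by (simp add: vertex_point_def)
qed

lemma marked_iff:
  assumes p: "p \<in> rectangles \<pi>t \<pi>b \<zeta>"
  shows "surface_pt \<pi>t \<pi>b \<zeta> p \<in> marked \<pi>t \<pi>b \<zeta> \<longleftrightarrow> vertex_point \<pi>t \<zeta> p"
proof -
  have inv: "vertex_point \<pi>t \<zeta> q \<longleftrightarrow> vertex_point \<pi>t \<zeta> r" if "equivclp (glue \<pi>t \<pi>b \<zeta>) q r" for q r
    using that by (induction rule: equivclp_induct) (auto dest: glue_vertex_point)
  have *: "marked \<pi>t \<pi>b \<zeta> =
      surface_pt \<pi>t \<pi>b \<zeta> ` {q \<in> rectangles \<pi>t \<pi>b \<zeta>. vertex_point \<pi>t \<zeta> q}"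
    unfolding marked_def by (rule arg_cong[where f = "image _"]) (auto simp: vertex_point_def)
  show ?thesis
  proof
    assume "surface_pt \<pi>t \<pi>b \<zeta> p \<in> marked \<pi>t \<pi>b \<zeta>"
    then obtain q where q: "q \<in> rectangles \<pi>t \<pi>b \<zeta>" "vertex_point \<pi>t \<zeta> q"
      "surface_pt \<pi>t \<pi>b \<zeta> p = surface_pt \<pi>t \<pi>b \<zeta> q" unfolding * by blast
    have "p \<in> surface_pt \<pi>t \<pi>b \<zeta> p"
      using p by (simp add: glue_rel_def)
    then have "equivclp (glue \<pi>t \<pi>b \<zeta>) q p" unfolding q(3) by (simp add: glue_rel_def)
    then show "vertex_point \<pi>t \<zeta> p" using inv q(2) by blast
  next
    assume "vertex_point \<pi>t \<zeta> p"
    then show "surface_pt \<pi>t \<pi>b \<zeta> p \<in> marked \<pi>t \<pi>b \<zeta>" unfolding * using p by blast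
  qed
qed

end

lemma surface_pt_eqI:
  assumes "p \<in> rectangles \<pi>t \<pi>b \<zeta>" "q \<in> rectangles \<pi>t \<pi>b \<zeta>" "equivclp (glue \<pi>t \<pi>b \<zeta>) p q"
  shows "surface_pt \<pi>t \<pi>b \<zeta> p = surface_pt \<pi>t \<pi>b \<zeta> q"
  by (rule equiv_class_eq[OF equiv_glue_rel]) (use assms in \<open>simp add: glue_rel_def\<close>)

lemma surface_pt_eqD:
  assumes "p \<in> rectangles \<pi>t \<pi>b \<zeta>" "surface_pt \<pi>t \<pi>b \<zeta> p = surface_pt \<pi>t \<pi>b \<zeta> q"
  shows "equivclp (glue \<pi>t \<pi>b \<zeta>) p q"
proof -
  have "p \<in> surface_pt \<pi>t \<pi>b \<zeta> p" using assms(1) by (simp add: glue_rel_def)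
  then show ?thesis unfolding assms(2) by (simp add: glue_rel_def equivclp_sym)
qed

lemma surface_ptI: "p \<in> rectangles \<pi>t \<pi>b \<zeta> \<Longrightarrow> surface_pt \<pi>t \<pi>b \<zeta> p \<in> surface \<pi>t \<pi>b \<zeta>"
  unfolding surface_def by (rule quotientI)


section \<open>Transport of horizontal connections\<close>

text \<open>
  The map \<open>\<phi>\<close> may tear a rectangle apart, as long as it induces a map of the glued surfaces.  As an orbit is described by what happens immediately after and immediately before
  each time, it suffices that horizontal motion is respected for a short time on either side of each
  point, up to a change of the representing rectangle.
\<close>

lemma connection_transfer:
  fixes \<phi> :: "'a::finite \<times> real \<times> real \<Rightarrow> 'a \<times> real \<times> real"
  assumes S': "suspension \<pi>t' \<pi>b' \<zeta>'" and S: "suspension \<pi>t \<pi>b \<zeta>"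
    and rect: "\<And>p. p \<in> rectangles \<pi>t' \<pi>b' \<zeta>' \<Longrightarrow> \<phi> p \<in> rectangles \<pi>t \<pi>b \<zeta>"
    and glue: "\<And>p q. glue \<pi>t' \<pi>b' \<zeta>' p q \<Longrightarrow> equivclp (glue \<pi>t \<pi>b \<zeta>) (\<phi> p) (\<phi> q)"
    and vertex: "\<And>p. p \<in> rectangles \<pi>t' \<pi>b' \<zeta>' \<Longrightarrow> vertex_point \<pi>t' \<zeta>' p \<longleftrightarrow> vertex_point \<pi>t \<zeta> (\<phi> p)"
    and right: "\<And>\<alpha> x y. (\<alpha>, x, y) \<in> rectangles \<pi>t' \<pi>b' \<zeta>' \<Longrightarrow> x < Re (\<zeta>' \<alpha>) \<Longrightarrow>
      \<exists>\<epsilon>>0. \<exists>\<beta> u v. \<forall>s\<in>{0..\<epsilon>}. (\<beta>, u + s, v) \<in> rectangles \<pi>t \<pi>b \<zeta> \<and>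
        equivclp (glue \<pi>t \<pi>b \<zeta>) (\<phi> (\<alpha>, x + s, y)) (\<beta>, u + s, v)"
    and left: "\<And>\<alpha> x y. (\<alpha>, x, y) \<in> rectangles \<pi>t' \<pi>b' \<zeta>' \<Longrightarrow> 0 < x \<Longrightarrow>
      \<exists>\<epsilon>>0. \<exists>\<beta> u v. \<forall>s\<in>{0..\<epsilon>}. (\<beta>, u - s, v) \<in> rectangles \<pi>t \<pi>b \<zeta> \<and>
        equivclp (glue \<pi>t \<pi>b \<zeta>) (\<phi> (\<alpha>, x - s, y)) (\<beta>, u - s, v)"
    and conn: "has_horizontal_connection \<pi>t' \<pi>b' \<zeta>'"
  shows "has_horizontal_connection \<pi>t \<pi>b \<zeta>"
proof -
  interpret S': suspension \<pi>t' \<pi>b' \<zeta>' by (fact S')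
  interpret S: suspension \<pi>t \<pi>b \<zeta> by (fact S)
  let ?R' = "rectangles \<pi>t' \<pi>b' \<zeta>'" and ?R = "rectangles \<pi>t \<pi>b \<zeta>"
  let ?pt' = "surface_pt \<pi>t' \<pi>b' \<zeta>'" and ?pt = "surface_pt \<pi>t \<pi>b \<zeta>"
  define \<Phi> where "\<Phi> X = ?pt (\<phi> (SOME p. p \<in> ?R' \<and> ?pt' p = X))" for X
  have \<phi>_equiv: "equivclp (glue \<pi>t \<pi>b \<zeta>) (\<phi> p) (\<phi> q)" if "equivclp (glue \<pi>t' \<pi>b' \<zeta>') p q" for p q
    using that
  proof (induction rule: equivclp_induct)
    case (step y z)
    then show ?case using glue equivclp_sym equivclp_trans by metis
  qed simp
  have \<Phi>: "\<Phi> (?pt' p) = ?pt (\<phi> p)" if p: "p \<in> ?R'" for p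
  proof -
    let ?q = "SOME q. q \<in> ?R' \<and> ?pt' q = ?pt' p"
    have q: "?q \<in> ?R' \<and> ?pt' ?q = ?pt' p" by (rule someI_ex) (use p in blast)
    then have "equivclp (glue \<pi>t' \<pi>b' \<zeta>') ?q p" using surface_pt_eqD by blast
    then show ?thesis unfolding \<Phi>_def using surface_pt_eqI rect q p \<phi>_equiv by blast
  qed
  obtain L c where L: "L > 0" and orbit: "horizontal_orbit \<pi>t' \<pi>b' \<zeta>' L c"
    and ends: "c 0 \<in> marked \<pi>t' \<pi>b' \<zeta>'" "c L \<in> marked \<pi>t' \<pi>b' \<zeta>'"
    and inner: "\<forall>t\<in>{0<..<L}. c t \<notin> marked \<pi>t' \<pi>b' \<zeta>'"
    using conn unfolding has_horizontal_connection_def by blast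
  have c_pt: "\<exists>p\<in>?R'. c t = ?pt' p" if "t \<in> {0..L}" for t
  proof -
    have "c t \<in> surface \<pi>t' \<pi>b' \<zeta>'" using orbit that unfolding horizontal_orbit_def by blast
    then show ?thesis unfolding surface_def by (metis quotientE)
  qed
  have c_marked: "c t \<in> marked \<pi>t' \<pi>b' \<zeta>' \<longleftrightarrow> \<Phi> (c t) \<in> marked \<pi>t \<pi>b \<zeta>" if "t \<in> {0..L}" for t
    using c_pt[OF that] S'.marked_iff S.marked_iff rect vertex by (metis \<Phi>)
  have "horizontal_orbit \<pi>t \<pi>b \<zeta> L (\<Phi> \<circ> c)"
    unfolding horizontal_orbit_def
  proof (intro conjI ballI)
    fix t assume t: "t \<in> {0..L}"
    then obtain p where "p \<in> ?R'" "c t = ?pt' p" using c_pt by blast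
    then show "(\<Phi> \<circ> c) t \<in> surface \<pi>t \<pi>b \<zeta>" using \<Phi> rect by (simp add: surface_ptI)
  next
    fix t assume t: "t \<in> {0..<L}"
    then obtain e \<alpha> x y where e: "e > 0" "t + e \<le> L"
      and ex: "\<forall>s\<in>{0..e}. (\<alpha>, x + s, y) \<in> ?R' \<and> c (t + s) = ?pt' (\<alpha>, x + s, y)"
      using orbit unfolding horizontal_orbit_def by blast
    have "(\<alpha>, x, y) \<in> ?R'" "x < Re (\<zeta>' \<alpha>)"
      using ex[rule_format, of 0] ex[rule_format, of e] e by (auto simp: rectangles_def)
    then obtain d \<beta> u v where d: "d > 0" and dx: "\<forall>s\<in>{0..d}. (\<beta>, u + s, v) \<in> ?R \<and>
        equivclp (glue \<pi>t \<pi>b \<zeta>) (\<phi> (\<alpha>, x + s, y)) (\<beta>, u + s, v)" using right by blast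
    have "\<forall>s\<in>{0..min e d}. (\<beta>, u + s, v) \<in> ?R \<and> (\<Phi> \<circ> c) (t + s) = ?pt (\<beta>, u + s, v)"
    proof
      fix s assume s: "s \<in> {0..min e d}"
      then have "(\<alpha>, x + s, y) \<in> ?R'" "c (t + s) = ?pt' (\<alpha>, x + s, y)" using ex by auto
      moreover have "(\<beta>, u + s, v) \<in> ?R"
        "equivclp (glue \<pi>t \<pi>b \<zeta>) (\<phi> (\<alpha>, x + s, y)) (\<beta>, u + s, v)" using s dx by auto
      ultimately show "(\<beta>, u + s, v) \<in> ?R \<and> (\<Phi> \<circ> c) (t + s) = ?pt (\<beta>, u + s, v)"
        using \<Phi> rect by (simp add: surface_pt_eqI[of "\<phi> _"])
    qed
    moreover have "min e d > 0" "t + min e d \<le> L" using e d by auto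
    ultimately show "\<exists>\<epsilon>>0. \<exists>\<alpha> x y. t + \<epsilon> \<le> L \<and> (\<forall>s\<in>{0..\<epsilon>}. (\<alpha>, x + s, y) \<in> ?R \<and>
        (\<Phi> \<circ> c) (t + s) = ?pt (\<alpha>, x + s, y))" by blast
  next
    fix t assume t: "t \<in> {0<..L}"
    then obtain e \<alpha> x y where e: "e > 0" "0 \<le> t - e"
      and ex: "\<forall>s\<in>{0..e}. (\<alpha>, x - s, y) \<in> ?R' \<and> c (t - s) = ?pt' (\<alpha>, x - s, y)"
      using orbit unfolding horizontal_orbit_def by blast
    have "(\<alpha>, x, y) \<in> ?R'" "0 < x"
      using ex[rule_format, of 0] ex[rule_format, of e] e by (auto simp: rectangles_def)
    then obtain d \<beta> u v where d: "d > 0" and dx: "\<forall>s\<in>{0..d}. (\<beta>, u - s, v) \<in> ?R \<and>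
        equivclp (glue \<pi>t \<pi>b \<zeta>) (\<phi> (\<alpha>, x - s, y)) (\<beta>, u - s, v)" using left by blast
    have "\<forall>s\<in>{0..min e d}. (\<beta>, u - s, v) \<in> ?R \<and> (\<Phi> \<circ> c) (t - s) = ?pt (\<beta>, u - s, v)"
    proof
      fix s assume s: "s \<in> {0..min e d}"
      then have "(\<alpha>, x - s, y) \<in> ?R'" "c (t - s) = ?pt' (\<alpha>, x - s, y)" using ex by auto
      moreover have "(\<beta>, u - s, v) \<in> ?R"
        "equivclp (glue \<pi>t \<pi>b \<zeta>) (\<phi> (\<alpha>, x - s, y)) (\<beta>, u - s, v)" using s dx by auto
      ultimately show "(\<beta>, u - s, v) \<in> ?R \<and> (\<Phi> \<circ> c) (t - s) = ?pt (\<beta>, u - s, v)"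
        using \<Phi> rect by (simp add: surface_pt_eqI[of "\<phi> _"])
    qed
    moreover have "min e d > 0" "0 \<le> t - min e d" using e d by auto
    ultimately show "\<exists>\<epsilon>>0. \<exists>\<alpha> x y. 0 \<le> t - \<epsilon> \<and> (\<forall>s\<in>{0..\<epsilon>}. (\<alpha>, x - s, y) \<in> ?R \<and>
        (\<Phi> \<circ> c) (t - s) = ?pt (\<alpha>, x - s, y))" by blast
  qed
  then show ?thesis
    unfolding has_horizontal_connection_def using L ends inner c_marked
    by (intro exI[of _ L] exI[of _ "\<Phi> \<circ> c"]) auto
qed


section \<open>Horizontal segments along the top row\<close>

lemma rectangles_iff:
  "(\<alpha>, x, y) \<in> rectangles \<pi>t \<pi>b \<zeta> \<longleftrightarrow>
    0 \<le> x \<and> x \<le> Re (\<zeta> \<alpha>) \<and> 0 \<le> y \<and> y \<le> height \<pi>t \<pi>b \<zeta> \<alpha>"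
  by (simp add: rectangles_def)

context suspension
begin

text \<open>
  The segment from \<open>U\<^sub>m\<close> to \<open>U\<^sub>q\<close> stays strictly below the top broken line in
  between, so it crosses each zipper below its end and passes through no vertex.
\<close>

lemma row_connection:
  assumes mq: "m < q" "q \<le> CARD('a)"
    and y: "Im (U m) = y" "Im (U q) = y" "\<And>k. m < k \<Longrightarrow> k < q \<Longrightarrow> y < Im (U k)"
    and yh: "\<And>\<alpha>. m < \<pi>t \<alpha> \<Longrightarrow> \<pi>t \<alpha> \<le> q \<Longrightarrow> y \<le> h \<alpha>"
  shows "has_horizontal_connection \<pi>t \<pi>b \<zeta>"
proof -
  let ?R = "rectangles \<pi>t \<pi>b \<zeta>" and ?pt = "surface_pt \<pi>t \<pi>b \<zeta>"
  define a where "a k = letter \<pi>t k" for k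
  define X where "X k = Re (U k) - Re (U m)" for k
  define L where "L = X q"
  have a: "\<pi>t (a k) = k" if "m < k" "k \<le> q" for k
    unfolding a_def using letter_at[OF top_bij] that mq by simp
  have X_m: "X m = 0" by (simp add: X_def)
  have X_step: "X k = X (k - 1) + Re (\<zeta> (a k))" if "m < k" "k \<le> q" for k
    using U_step[of "a k"] a[OF that] by (simp add: X_def)
  have X_less: "X i < X k" if "i < k" "k \<le> q" for i k
    using vertex_Re_less[where \<zeta> = \<zeta>, OF top_bij width_pos] that mq by (simp add: X_def)
  have X_mono: "X i \<le> X k" if "i \<le> k" "k \<le> q" for i k
    using X_less[of i k] that by (cases "i = k") auto
  have L: "0 < L" using X_less[of m q] mq X_m by (simp add: L_def)
  have y0: "0 \<le> y" using y(1) U_nonneg[of m] mq by simp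
  have rect: "(a k, t - X (k - 1), y) \<in> ?R" if "m < k" "k \<le> q" "X (k - 1) \<le> t" "t \<le> X k" for k t
    using that X_step[of k] y0 yh[of "a k"] a[of k] by (simp add: rectangles_iff)
  \<comment> \<open>The place of the rectangle visited at time \<open>t\<close>; on a common side the left one is taken.\<close>
  define n where "n t = (LEAST k. m < k \<and> t \<le> X k)" for t
  have n: "m < n t" "n t \<le> q" "t \<le> X (n t)" if "t \<le> L" for t
  proof -
    have q: "m < q \<and> t \<le> X q" using that mq by (simp add: L_def)
    show "m < n t" "t \<le> X (n t)" unfolding n_def using LeastI[of "\<lambda>k. m < k \<and> t \<le> X k", OF q] by auto
    show "n t \<le> q" unfolding n_def by (rule Least_le) (rule q)
  qed
  have n_gt: "X (n t - 1) < t" if "0 < t" "t \<le> L" for t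
  proof (cases "m < n t - 1")
    case True
    then show ?thesis using not_less_Least[of "n t - 1" "\<lambda>k. m < k \<and> t \<le> X k"]
      by (auto simp: n_def[symmetric])
  next
    case False
    then have "n t - 1 = m" using n(1)[OF that(2)] by simp
    then show ?thesis using that X_m by simp
  qed
  define c where "c t = ?pt (a (n t), t - X (n t - 1), y)" for t
  have c: "c t = ?pt (a k, t - X (k - 1), y)"
    if k: "m < k" "k \<le> q" and t: "X (k - 1) \<le> t" "t \<le> X k" for k t
  proof (cases "n t = k")
    case False
    \<comment> \<open>Two rectangles claim \<open>t\<close> only on their common side, and there they are zipped together.\<close>
    have tL: "t \<le> L" using t X_mono[of k q] k by (simp add: L_def)
    have "n t \<le> k" unfolding n_def by (rule Least_le) (use k t in simp)
    with False have lt: "n t < k" by simp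
    have "\<not> n t < k - 1"
      using X_less[of "n t" "k - 1"] k t n(3)[OF tL] by fastforce
    with lt have nk: "n t = k - 1" by simp
    then have t_eq: "t = X (k - 1)" using t n(3)[OF tL] by simp
    have mk: "m < k - 1" "k - 1 \<le> q" using n(1)[OF tL] nk k by auto
    note st = X_step[OF mk]
    have yU: "y < Im (U (k - 1))" using y(3)[of "k - 1"] mk k by linarith
    have "glue \<pi>t \<pi>b \<zeta> (a (k - 1), Re (\<zeta> (a (k - 1))), y) (a k, 0, y)"
      by (rule glue.zip_top)
        (use a[OF k] a[OF mk] k y0 yU yh[of "a (k - 1)"] mk in auto)
    then have "?pt (a (k - 1), t - X (k - 1 - 1), y) = ?pt (a k, t - X (k - 1), y)"
      by (intro surface_pt_eqI rect) (use k mk t st t_eq width_pos[of "a (k - 1)"] in auto)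
    then show ?thesis by (simp add: c_def nk)
  qed (simp add: c_def)
  have c_n: "c t = ?pt (a (n t), t - X (n t - 1), y)" "(a (n t), t - X (n t - 1), y) \<in> ?R"
    if "0 < t" "t \<le> L" for t
    using c_def rect n[OF that(2)] n_gt[OF that] by auto
  have c_0: "c 0 = ?pt (a (Suc m), 0, y)" "(a (Suc m), 0, y) \<in> ?R"
    using c[of "Suc m" 0] rect[of "Suc m" 0] mq X_m X_less[of m "Suc m"] by auto
  have orbit: "horizontal_orbit \<pi>t \<pi>b \<zeta> L c"
    unfolding horizontal_orbit_def
  proof (intro conjI ballI)
    fix t assume "t \<in> {0..L}"
    then show "c t \<in> surface \<pi>t \<pi>b \<zeta>"
      using c_0 c_n[of t] by (cases "t = 0") (auto simp: surface_ptI)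
  next
    fix t assume t: "t \<in> {0..<L}"
    define k where "k = (LEAST k. m < k \<and> t < X k)"
    have q: "m < q \<and> t < X q" using t mq by (simp add: L_def)
    have k: "m < k" "t < X k" unfolding k_def using LeastI[of "\<lambda>k. m < k \<and> t < X k", OF q] by auto
    have kq: "k \<le> q" unfolding k_def by (rule Least_le) (rule q)
    have kt: "X (k - 1) \<le> t"
    proof (cases "m < k - 1")
      case True
      then show ?thesis using not_less_Least[of "k - 1" "\<lambda>k. m < k \<and> t < X k"]
        by (auto simp: k_def[symmetric])
    next
      case False
      then have "k - 1 = m" using k by simp
      then show ?thesis using t X_m by simp
    qed
    have "\<forall>s\<in>{0..X k - t}. (a k, t - X (k - 1) + s, y) \<in> ?R \<and>
        c (t + s) = ?pt (a k, t - X (k - 1) + s, y)"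
      using c[OF k(1) kq] rect[OF k(1) kq] kt by (auto simp: algebra_simps)
    moreover have "X k - t > 0" "t + (X k - t) \<le> L" using k kq X_mono[of k q] by (auto simp: L_def)
    ultimately show "\<exists>\<epsilon>>0. \<exists>\<alpha> x y. t + \<epsilon> \<le> L \<and> (\<forall>s\<in>{0..\<epsilon>}. (\<alpha>, x + s, y) \<in> ?R \<and>
        c (t + s) = ?pt (\<alpha>, x + s, y))" by blast
  next
    fix t assume t: "t \<in> {0<..L}"
    let ?k = "n t"
    have "\<forall>s\<in>{0..t - X (?k - 1)}. (a ?k, t - X (?k - 1) - s, y) \<in> ?R \<and>
        c (t - s) = ?pt (a ?k, t - X (?k - 1) - s, y)"
    proof
      fix s assume s: "s \<in> {0..t - X (?k - 1)}"
      have "X (?k - 1) \<le> t - s" "t - s \<le> X ?k" using s n(3)[of t] t by auto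
      moreover have "t - s - X (?k - 1) = t - X (?k - 1) - s" by simp
      ultimately show "(a ?k, t - X (?k - 1) - s, y) \<in> ?R \<and> c (t - s) = ?pt (a ?k, t - X (?k - 1) - s, y)"
        using c[of ?k "t - s"] rect[of ?k "t - s"] n(1,2)[of t] t by (metis greaterThanAtMost_iff)
    qed
    moreover have "t - X (?k - 1) > 0" using n_gt t by simp
    moreover have "0 \<le> t - (t - X (?k - 1))"
      using X_mono[of m "?k - 1"] X_m n[of t] t by simp
    ultimately show "\<exists>\<epsilon>>0. \<exists>\<alpha> x y. 0 \<le> t - \<epsilon> \<and> (\<forall>s\<in>{0..\<epsilon>}. (\<alpha>, x - s, y) \<in> ?R \<and>
        c (t - s) = ?pt (\<alpha>, x - s, y))" by blast
  qed
  have first: "c 0 \<in> marked \<pi>t \<pi>b \<zeta>"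
    unfolding c_0(1) marked_iff[OF c_0(2)]
    by (rule vertex_pointI_left) (use a[of "Suc m"] mq y in simp)
  have nL: "n L = q"
  proof (rule ccontr)
    assume "n L \<noteq> q"
    then have "X (n L) < L" unfolding L_def using n[of L] by (intro X_less) (auto simp: L_def)
    then show False using n(3)[of L] by simp
  qed
  have last: "c L \<in> marked \<pi>t \<pi>b \<zeta>"
    unfolding c_n(1)[OF L order_refl] marked_iff[OF c_n(2)[OF L order_refl]]
    using vertex_pointI_right[of y \<pi>t \<zeta> "a q"] a[of q] mq y X_step[of q] nL
    unfolding nL by (simp add: L_def)
  have "c t \<notin> marked \<pi>t \<pi>b \<zeta>" if t: "0 < t" "t < L" for t
  proof
    have tL: "t \<le> L" using t by simp
    assume "c t \<in> marked \<pi>t \<pi>b \<zeta>"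
    then have v: "vertex_point \<pi>t \<zeta> (a (n t), t - X (n t - 1), y)"
      unfolding c_n(1)[OF t(1) tL] marked_iff[OF c_n(2)[OF t(1) tL]] .
    moreover have "t - X (n t - 1) \<noteq> 0" using n_gt[OF t(1) tL] by simp
    ultimately have *: "t - X (n t - 1) = Re (\<zeta> (a (n t)))" "y = Im (U (n t))"
      using a n[OF tL] by (auto simp: vertex_point_def)
    then have "t = X (n t)" using X_step[of "n t"] n[OF tL] by simp
    then have "n t \<noteq> q" using t by (auto simp: L_def)
    then show False using y(3)[of "n t"] * n[OF tL] by simp
  qed
  then show ?thesis unfolding has_horizontal_connection_def
    using L orbit first last by (intro exI[of _ L] exI[of _ c]) auto
qed

end


section \<open>The reflection exchanging the two rows\<close>

context suspension
begin

lemma height_swap: "height \<pi>b \<pi>t (cnj \<circ> \<zeta>) = h"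
  by (simp add: fun_eq_iff height_def vertex_cnj)

text \<open>
  The reflection turns each rectangle upside down.  It exchanges the roles of top and base in the
  gluing of the base segment, the top zippers with the bottom zippers, and the two rules for the last
  vertex with each other.
\<close>

lemma swap_connection:
  assumes "has_horizontal_connection \<pi>t \<pi>b \<zeta>"
  shows "has_horizontal_connection \<pi>b \<pi>t (cnj \<circ> \<zeta>)"
proof -
  define \<phi> :: "'a \<times> real \<times> real \<Rightarrow> 'a \<times> real \<times> real"
    where "\<phi> = (\<lambda>(\<alpha>, x, y). (\<alpha>, x, h \<alpha> - y))"
  have rect: "\<phi> p \<in> rectangles \<pi>b \<pi>t (cnj \<circ> \<zeta>)" if "p \<in> rectangles \<pi>t \<pi>b \<zeta>" for p
    using that by (cases p) (auto simp: \<phi>_def rectangles_iff height_swap)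
  have glue: "glue \<pi>b \<pi>t (cnj \<circ> \<zeta>) (\<phi> p) (\<phi> q) \<or> glue \<pi>b \<pi>t (cnj \<circ> \<zeta>) (\<phi> q) (\<phi> p)"
    if "glue \<pi>t \<pi>b \<zeta> p q" for p q
    using that
  proof cases
    case (base x \<alpha> x' \<alpha>')
    then show ?thesis
      using glue.base[where \<pi>t = \<pi>b and \<pi>b = \<pi>t and \<zeta> = "cnj \<circ> \<zeta>" and x = x' and \<alpha> = \<alpha>' and x' = x and \<alpha>' = \<alpha>]
      by (simp add: \<phi>_def vertex_cnj height_swap)
  next
    case (zip_top \<alpha>' \<alpha> y)
    then show ?thesis
      using glue.zip_bot[where \<pi>t = \<pi>b and \<pi>b = \<pi>t and \<zeta> = "cnj \<circ> \<zeta>" and s = y and \<alpha> = \<alpha> and \<alpha>' = \<alpha>']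
      by (simp add: \<phi>_def vertex_cnj height_swap)
  next
    case (zip_bot \<alpha>' \<alpha> s)
    then show ?thesis
      using glue.zip_top[where \<pi>t = \<pi>b and \<pi>b = \<pi>t and \<zeta> = "cnj \<circ> \<zeta>" and y = s and \<alpha> = \<alpha> and \<alpha>' = \<alpha>']
      by (simp add: \<phi>_def vertex_cnj height_swap)
  next
    case (end_top \<alpha> \<beta> \<beta>' y)
    then show ?thesis
      using glue.end_bot[where \<pi>t = \<pi>b and \<pi>b = \<pi>t and \<zeta> = "cnj \<circ> \<zeta>" and s = y and \<alpha> = \<beta> and \<alpha>' = \<beta>' and \<beta> = \<alpha>]
      by (simp add: \<phi>_def height_swap sum_negf algebra_simps)
  next
    case (end_bot \<alpha> \<beta> \<alpha>' s)
    then show ?thesis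
      using glue.end_top[where \<pi>t = \<pi>b and \<pi>b = \<pi>t and \<zeta> = "cnj \<circ> \<zeta>" and y = s and \<beta> = \<alpha> and \<beta>' = \<alpha>' and \<alpha> = \<beta>]
      by (simp add: \<phi>_def height_swap sum_negf algebra_simps)
  qed
  show ?thesis
  proof (rule connection_transfer[where \<phi> = \<phi>, OF suspension_axioms swap rect _ _ _ _ assms])
    show "equivclp (glue \<pi>b \<pi>t (cnj \<circ> \<zeta>)) (\<phi> p) (\<phi> q)" if "glue \<pi>t \<pi>b \<zeta> p q" for p q
      using glue[OF that] by auto
    show "vertex_point \<pi>t \<zeta> p \<longleftrightarrow> vertex_point \<pi>b (cnj \<circ> \<zeta>) (\<phi> p)" for p
    proof (cases p)
      case (fields \<alpha> x y)
      have "h \<alpha> - y = - Im (V (\<pi>b \<alpha> - 1)) \<longleftrightarrow> y = Im (U (\<pi>t \<alpha> - 1))"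
        "h \<alpha> - y = - Im (V (\<pi>b \<alpha>)) \<longleftrightarrow> y = Im (U (\<pi>t \<alpha>))"
        unfolding height_left U_step V_step by auto
      then show ?thesis by (simp add: fields \<phi>_def vertex_point_def vertex_cnj)
    qed
    fix \<alpha> x y assume p: "(\<alpha>, x, y) \<in> rectangles \<pi>t \<pi>b \<zeta>"
    show "\<exists>\<epsilon>>0. \<exists>\<beta> u v. \<forall>s\<in>{0..\<epsilon>}. (\<beta>, u + s, v) \<in> rectangles \<pi>b \<pi>t (cnj \<circ> \<zeta>) \<and>
        equivclp (glue \<pi>b \<pi>t (cnj \<circ> \<zeta>)) (\<phi> (\<alpha>, x + s, y)) (\<beta>, u + s, v)" if "x < Re (\<zeta> \<alpha>)"
      by (rule exI[of _ "Re (\<zeta> \<alpha>) - x"], rule conjI, use that in simp,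
          rule exI[of _ \<alpha>], rule exI[of _ x], rule exI[of _ "h \<alpha> - y"])
        (use p in \<open>auto simp: \<phi>_def rectangles_iff height_swap\<close>)
    show "\<exists>\<epsilon>>0. \<exists>\<beta> u v. \<forall>s\<in>{0..\<epsilon>}. (\<beta>, u - s, v) \<in> rectangles \<pi>b \<pi>t (cnj \<circ> \<zeta>) \<and>
        equivclp (glue \<pi>b \<pi>t (cnj \<circ> \<zeta>)) (\<phi> (\<alpha>, x - s, y)) (\<beta>, u - s, v)" if "0 < x"
      by (rule exI[of _ x], rule conjI, use that in simp,
          rule exI[of _ \<alpha>], rule exI[of _ x], rule exI[of _ "h \<alpha> - y"])
        (use p in \<open>auto simp: \<phi>_def rectangles_iff height_swap\<close>)
  qed
qed

end


section \<open>Cutting and pasting: a backward step of top type\<close>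

locale top_step = suspension +
  fixes w l
  assumes w_last: "\<pi>t w = CARD('a)"
    and l_next: "\<pi>b l = \<pi>b w + 1"
    and sum_neg: "Im (\<Sum>\<alpha>\<in>UNIV. \<zeta> \<alpha>) < 0"
begin

abbreviation "\<pi>b' \<equiv> move_last l \<pi>b"
abbreviation "\<zeta>' \<equiv> \<zeta>(w := \<zeta> w + \<zeta> l)"
abbreviation "h' \<equiv> height \<pi>t \<pi>b' \<zeta>'"

lemma w_neq_l: "w \<noteq> l" using l_next by auto

lemma bot_bij': "bij_betw \<pi>b' UNIV {1..CARD('a)}"
proof -
  have "inj \<pi>b'"
  proof (rule injI)
    fix \<alpha> \<beta> assume "\<pi>b' \<alpha> = \<pi>b' \<beta>"
    then show "\<alpha> = \<beta>"
      using bot_bounds[of \<alpha>] bot_bounds[of \<beta>] bot_bounds[of l] bot_eq_iff[of \<alpha> \<beta>]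
        bot_eq_iff[of \<alpha> l] bot_eq_iff[of \<beta> l]
      by (auto simp: move_last_def split: if_splits)
  qed
  moreover have "\<pi>b' \<alpha> \<in> {1..CARD('a)}" for \<alpha>
    using bot_bounds[of \<alpha>] bot_bounds[of l] by (auto simp: move_last_def)
  ultimately have "range \<pi>b' = {1..CARD('a)}"
    by (intro card_subset_eq) (auto simp only: card_image card_atLeastAtMost finite_atLeastAtMost)
  with \<open>inj \<pi>b'\<close> show ?thesis by (simp add: bij_betw_def)
qed

lemma sum_step: "sum \<zeta>' A = sum \<zeta> A + (if w \<in> A then \<zeta> l else 0)"
proof -
  have "sum \<zeta>' A = (\<Sum>\<alpha>\<in>A. \<zeta> \<alpha> + (if \<alpha> = w then \<zeta> l else 0))" by (rule sum.cong) auto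
  then show ?thesis by (simp add: sum.distrib sum.delta)
qed

lemma U_step_eq: "vertex \<pi>t \<zeta>' k = U k" if "k < CARD('a)"
  using that w_last unfolding vertex_def sum_step by simp

lemma V_step_low: "vertex \<pi>b' \<zeta>' k = V k" if "k < \<pi>b w"
proof -
  have "{\<alpha>. \<pi>b' \<alpha> \<le> k} = {\<alpha>. \<pi>b \<alpha> \<le> k}"
    using that l_next bot_bounds[of l] by (auto simp: move_last_def)
  then show ?thesis using that unfolding vertex_def sum_step by simp
qed

text \<open>
  In the bottom row the letter \<open>l\<close> jumps to the end, but its vector is added to the one of its
  left neighbour \<open>w\<close>; so, up to the new last side, the bottom line only loses the vertex between the
  two.
\<close>

lemma V_step_high: "vertex \<pi>b' \<zeta>' k = V (k + 1)" if "\<pi>b w \<le> k" "k < CARD('a)"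
proof -
  have "\<pi>b \<alpha> \<le> k + 1 \<longleftrightarrow> \<alpha> = l \<or> \<pi>b' \<alpha> \<le> k" for \<alpha>
    using that l_next bot_bounds[of l] bot_eq_iff[of \<alpha> l] by (auto simp: move_last_def)
  then have "{\<alpha>. \<pi>b \<alpha> \<le> k + 1} = insert l {\<alpha>. \<pi>b' \<alpha> \<le> k}" by blast
  moreover have "\<pi>b' l > k" "\<pi>b' w \<le> k" using that w_neq_l l_next by (auto simp: move_last_def)
  ultimately show ?thesis unfolding vertex_def sum_step by (simp add: add.commute)
qed

lemma top_left: "vertex \<pi>t \<zeta>' (\<pi>t \<alpha> - 1) = U (\<pi>t \<alpha> - 1)"
  using U_step_eq[of "\<pi>t \<alpha> - 1"] top_bounds[of \<alpha>] by simp

lemma top_right: "\<alpha> \<noteq> w \<Longrightarrow> vertex \<pi>t \<zeta>' (\<pi>t \<alpha>) = U (\<pi>t \<alpha>)"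
  using U_step_eq[of "\<pi>t \<alpha>"] top_bounds[of \<alpha>] top_eq_iff[of \<alpha> w] w_last by simp

lemma sum_step_UNIV: "sum \<zeta>' UNIV = Z + \<zeta> l"
  using sum_step[of UNIV] by (simp del: fun_upd_apply)

lemma top_right_w: "vertex \<pi>t \<zeta>' (\<pi>t w) = Z + \<zeta> l"
  unfolding w_last vertex_last[OF top_bij] sum_step_UNIV ..

lemma bot_order:
  assumes "\<alpha> \<noteq> l"
  shows "\<pi>b \<alpha> \<le> \<pi>b w \<and> \<pi>b' \<alpha> = \<pi>b \<alpha> \<or> \<pi>b l < \<pi>b \<alpha> \<and> \<pi>b' \<alpha> = \<pi>b \<alpha> - 1"
  using assms l_next bot_eq_iff[of \<alpha> l] by (auto simp: move_last_def)

lemma bot_l: "\<pi>b' l = CARD('a)" by (simp add: move_last_def)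

lemma bot_left: "vertex \<pi>b' \<zeta>' (\<pi>b' \<alpha> - 1) = V (\<pi>b \<alpha> - 1)" if "\<alpha> \<noteq> l"
  using bot_order[OF that]
proof
  assume "\<pi>b \<alpha> \<le> \<pi>b w \<and> \<pi>b' \<alpha> = \<pi>b \<alpha>"
  moreover from this have "\<pi>b \<alpha> - 1 < \<pi>b w" using bot_bounds[of \<alpha>] by linarith
  ultimately show ?thesis using V_step_low[of "\<pi>b \<alpha> - 1"] by simp
next
  assume "\<pi>b l < \<pi>b \<alpha> \<and> \<pi>b' \<alpha> = \<pi>b \<alpha> - 1"
  moreover from this have "\<pi>b w \<le> \<pi>b \<alpha> - 2" "\<pi>b \<alpha> - 2 < CARD('a)" "\<pi>b \<alpha> - 2 + 1 = \<pi>b \<alpha> - 1"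
    using bot_bounds[of \<alpha>] l_next by linarith+
  moreover have "\<pi>b \<alpha> - 1 - 1 = \<pi>b \<alpha> - 2" by simp
  ultimately show ?thesis using V_step_high[of "\<pi>b \<alpha> - 2"] by presburger
qed

lemma bot_left_l: "vertex \<pi>b' \<zeta>' (\<pi>b' l - 1) = Z"
  using V_step_high[of "CARD('a) - 1"] bot_bounds[of l] l_next two_letters V_last
  by (simp add: bot_l)

lemma bot_right: "vertex \<pi>b' \<zeta>' (\<pi>b' \<alpha>) = V (\<pi>b \<alpha>)" if "\<alpha> \<noteq> l" "\<alpha> \<noteq> w"
  using bot_order[OF that(1)]
proof
  assume "\<pi>b \<alpha> \<le> \<pi>b w \<and> \<pi>b' \<alpha> = \<pi>b \<alpha>"
  then show ?thesis using V_step_low[of "\<pi>b \<alpha>"] bot_eq_iff[of \<alpha> w] that by simp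
next
  assume "\<pi>b l < \<pi>b \<alpha> \<and> \<pi>b' \<alpha> = \<pi>b \<alpha> - 1"
  moreover from this have "\<pi>b w \<le> \<pi>b \<alpha> - 1" "\<pi>b \<alpha> - 1 < CARD('a)" "\<pi>b \<alpha> - 1 + 1 = \<pi>b \<alpha>"
    using bot_bounds[of \<alpha>] l_next by linarith+
  ultimately show ?thesis using V_step_high[of "\<pi>b \<alpha> - 1"] by presburger
qed

lemma bot_w: "\<pi>b' w = \<pi>b w"
  using bot_order[OF w_neq_l] l_next by auto

lemma bot_right_w: "vertex \<pi>b' \<zeta>' (\<pi>b' w) = V (\<pi>b l)"
  using V_step_high[of "\<pi>b w"] bot_bounds[of l] l_next by (simp add: bot_w)

lemma suspension_step: "suspension \<pi>t \<pi>b' \<zeta>'"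
proof
  fix k assume k: "1 \<le> k" "k < CARD('a)"
  show "0 < Im (vertex \<pi>t \<zeta>' k)" using k U_step_eq top_pos by simp
  show "Im (vertex \<pi>b' \<zeta>' k) < 0"
  proof (cases "k < \<pi>b w")
    case False
    then show ?thesis using V_step_high[of k] k bot_neg[of "k + 1"] V_last sum_neg
      by (cases "k + 1 = CARD('a)") auto
  qed (use k V_step_low bot_neg in simp)
qed (use two_letters top_bij bot_bij' width_pos in \<open>auto intro: add_pos_pos\<close>)

lemma height_w: "h w = Im Z - Im (V (\<pi>b w))"
  by (simp add: height_def w_last U_last)

lemma height_l: "h l = Im (U (\<pi>t l - 1)) - Im (V (\<pi>b w))"
  by (simp add: height_left l_next)

lemma Re_Z: "Re Z = Re (U (\<pi>t w - 1)) + Re (\<zeta> w)"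
  using U_step[of w] w_last U_last by (metis plus_complex.sel(1))

lemma V_l: "V (\<pi>b l) = V (\<pi>b w) + \<zeta> l"
  using V_step[of l] l_next by simp

lemma height_step: "h' \<alpha> = (if \<alpha> = l then h l - h w else h \<alpha>)"
proof (cases "\<alpha> = l")
  case True
  then show ?thesis
    using top_left[of l] bot_left_l
    by (simp add: suspension.height_left[OF suspension_step] height_w height_l del: fun_upd_apply)
next
  case False
  then show ?thesis using top_left[of \<alpha>] bot_left[of \<alpha>]
    by (simp add: suspension.height_left[OF suspension_step] height_left del: fun_upd_apply)
qed

lemma height_w_less: "h w < h l"
  using suspension.height_pos[OF suspension_step, of l] by (simp add: height_step)

lemma bot_succ_step:
  assumes "\<pi>b' \<beta> = \<pi>b' \<alpha> + 1"
  shows "\<alpha> \<noteq> l" and "\<alpha> = w \<Longrightarrow> \<beta> \<noteq> l \<Longrightarrow> \<pi>b \<beta> = \<pi>b l + 1" and "\<alpha> = w \<Longrightarrow> \<beta> = l \<Longrightarrow> \<pi>b l = CARD('a)"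
    and "\<alpha> \<noteq> w \<Longrightarrow> \<beta> = l \<Longrightarrow> \<pi>b \<alpha> = CARD('a)" and "\<alpha> \<noteq> w \<Longrightarrow> \<beta> \<noteq> l \<Longrightarrow> \<pi>b \<beta> = \<pi>b \<alpha> + 1"
proof -
  show nl: "\<alpha> \<noteq> l" using assms bot_l position_bounds(2)[OF bot_bij', of \<beta>] by auto
  show "\<pi>b \<beta> = \<pi>b l + 1" if "\<alpha> = w" "\<beta> \<noteq> l"
    using assms that bot_order[of \<beta>] bot_w l_next by auto
  show "\<pi>b l = CARD('a)" if "\<alpha> = w" "\<beta> = l"
    using assms that bot_l bot_w l_next by auto
  show "\<pi>b \<alpha> = CARD('a)" if "\<alpha> \<noteq> w" "\<beta> = l"
    using assms that bot_order[OF nl] bot_l bot_bounds[of \<alpha>] bot_bounds[of l] l_next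
      bot_eq_iff[of \<alpha> w] by auto
  show "\<pi>b \<beta> = \<pi>b \<alpha> + 1" if "\<alpha> \<noteq> w" "\<beta> \<noteq> l"
    using assms bot_order[OF nl] bot_order[OF that(2)] bot_eq_iff[of \<alpha> w] that(1) l_next
      bot_bounds[of \<alpha>] bot_bounds[of \<beta>] by auto
qed

text \<open>
  Because \<open>U\<^sub>d\<close> is below the base, the right side of the rectangle of \<open>w\<close> is zipped
  completely to the top part of the left side of the rectangle of \<open>l\<close>.  The step cuts off this part of \<open>l\<close>, of height \<open>h w\<close>, and pastes it to
  the right of \<open>w\<close>; the map below sends each point of the new rectangles back to its old place.
\<close>

definition unpaste :: "'a \<times> real \<times> real \<Rightarrow> 'a \<times> real \<times> real" where
  "unpaste = (\<lambda>(\<alpha>, x, y). if \<alpha> = w \<and> Re (\<zeta> w) < x then (l, x - Re (\<zeta> w), y + (h l - h w)) else (\<alpha>, x, y))"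

lemma unpaste_simps:
  "\<alpha> \<noteq> w \<Longrightarrow> unpaste (\<alpha>, x, y) = (\<alpha>, x, y)"
  "x \<le> Re (\<zeta> w) \<Longrightarrow> unpaste (\<alpha>, x, y) = (\<alpha>, x, y)"
  "0 < x \<Longrightarrow> unpaste (w, Re (\<zeta> w) + x, y) = (l, x, y + (h l - h w))"
  by (auto simp: unpaste_def)

lemma unpaste_0: "unpaste (\<alpha>, 0, y) = (\<alpha>, 0, y)"
  using width_pos[of w] by (simp add: unpaste_def)

lemma seam:
  assumes "0 \<le> y" "y \<le> h w"
  shows "glue \<pi>t \<pi>b \<zeta> (w, Re (\<zeta> w), y) (l, 0, y + (h l - h w))"
proof -
  have "glue \<pi>t \<pi>b \<zeta> (w, Re (\<zeta> w), h w - (h w - y)) (l, 0, h l - (h w - y))"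
    by (rule glue.zip_bot) (use assms l_next sum_neg height_w in auto)
  then show ?thesis by (simp add: algebra_simps)
qed

lemma unpaste_rectangles:
  assumes "p \<in> rectangles \<pi>t \<pi>b' \<zeta>'"
  shows "unpaste p \<in> rectangles \<pi>t \<pi>b \<zeta>"
proof (cases p)
  case (fields \<alpha> x y)
  then show ?thesis
    using assms height_w_less height_pos[of w] w_neq_l
    by (auto simp: unpaste_def rectangles_iff height_step split: if_splits)
qed

lemma unpaste_vertex_point:
  assumes "p \<in> rectangles \<pi>t \<pi>b' \<zeta>'"
  shows "vertex_point \<pi>t \<zeta>' p \<longleftrightarrow> vertex_point \<pi>t \<zeta> (unpaste p)"
proof (cases p)
  case (fields \<alpha> x y)
  have r: "0 \<le> x" "x \<le> Re (\<zeta>' \<alpha>)" "0 \<le> y" using assms by (simp_all add: fields rectangles_iff)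
  show ?thesis
  proof (cases "\<alpha> = w")
    case False
    then show ?thesis using top_left[of \<alpha>] top_right[OF False]
      by (simp add: fields unpaste_simps vertex_point_def)
  next
    case True
    \<comment> \<open>The vertex \<open>U\<^sub>d\<close> lies below the base, so it is not on the seam.\<close>
    have U: "Im (U (\<pi>t w)) < 0" using w_last U_last sum_neg by simp
    have l: "U (\<pi>t l) = U (\<pi>t l - 1) + \<zeta> l" by (rule U_step)
    show ?thesis
    proof (cases "x \<le> Re (\<zeta> w)")
      case le: True
      then show ?thesis using True U r(3) top_left[of w] width_pos[of l]
        by (auto simp: fields unpaste_simps vertex_point_def)
    next
      case False
      then have e: "unpaste p = (l, x - Re (\<zeta> w), y + (h l - h w))" by (simp add: fields unpaste_def True)
      have "y + (h l - h w) = Im (U (\<pi>t l)) \<longleftrightarrow> y = Im (Z + \<zeta> l)"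
        unfolding l height_l height_w by auto
      then have "vertex_point \<pi>t \<zeta> (unpaste p) \<longleftrightarrow> x = Re (\<zeta> w + \<zeta> l) \<and> y = Im (Z + \<zeta> l)"
        using False unfolding e by (auto simp: vertex_point_def)
      moreover have "vertex_point \<pi>t \<zeta>' p \<longleftrightarrow> x = Re (\<zeta> w + \<zeta> l) \<and> y = Im (Z + \<zeta> l)"
        using False width_pos[of w] unfolding fields True vertex_point_def case_prod_conv top_right_w
        by auto
      ultimately show ?thesis by simp
    qed
  qed
qed

text \<open>
  The old base segment is the part of the new one to the left of \<open>Re Z\<close>, and there nothing
  changes.  The added part is the base of the pasted piece.  It is the cut through the old rectangle
  of \<open>l\<close>, and indeed the top of the new rectangle of \<open>l\<close>, now last in the bottom row, is glued to it.
\<close>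

lemma unpaste_base:
  assumes x: "0 \<le> x" "x \<le> Re (\<zeta>' \<alpha>)" "0 \<le> x'" "x' \<le> Re (\<zeta>' \<alpha>')"
    and eq: "Re (vertex \<pi>b' \<zeta>' (\<pi>b' \<alpha> - 1)) + x = Re (vertex \<pi>t \<zeta>' (\<pi>t \<alpha>' - 1)) + x'"
  shows "equivclp (glue \<pi>t \<pi>b \<zeta>) (unpaste (\<alpha>, x, h' \<alpha>)) (unpaste (\<alpha>', x', 0))"
proof (cases "\<alpha> = l")
  case True
  have eq': "Re Z + x = Re (U (\<pi>t \<alpha>' - 1)) + x'" using eq bot_left_l top_left[of \<alpha>'] True by simp
  have \<alpha>': "\<alpha>' = w"
  proof (rule ccontr)
    assume "\<alpha>' \<noteq> w"
    moreover from this have "\<pi>t \<alpha>' \<noteq> CARD('a)" using top_eq_iff w_last by metis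
    ultimately show False using base_position(2,3)[OF top_bij x(3), of \<alpha>'] x eq' by simp
  qed
  have x': "x' = Re (\<zeta> w) + x" using eq' \<alpha>' Re_Z by (simp del: Re_sum)
  have H: "h' l = h l - h w" by (simp add: height_step)
  show ?thesis
  proof (cases "x = 0")
    case True
    show ?thesis using seam[of 0] height_pos[of w] w_neq_l
      by (auto simp: True \<open>\<alpha> = l\<close> \<alpha>' x' H unpaste_simps unpaste_0 intro: converse_r_into_equivclp)
  next
    case False
    then show ?thesis using x w_neq_l by (simp add: True \<alpha>' x' H unpaste_simps)
  qed
next
  case False
  \<comment> \<open>Both sides are a top and a base point of the old surface; \<open>P\<close> is their common position in the
      old base segment.\<close>
  define P where "P = Re (V (\<pi>b \<alpha> - 1)) + x"
  have P': "P = Re (U (\<pi>t \<alpha>' - 1)) + x'" using eq bot_left[OF False] top_left[of \<alpha>'] by (simp add: P_def)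
  have hH: "h' \<alpha> = h \<alpha>" using False by (simp add: height_step)
  have "\<exists>\<beta> u. unpaste (\<alpha>, x, h' \<alpha>) = (\<beta>, u, h \<beta>) \<and> 0 \<le> u \<and> u \<le> Re (\<zeta> \<beta>) \<and> P = Re (V (\<pi>b \<beta> - 1)) + u"
  proof (cases "\<alpha> = w \<and> Re (\<zeta> w) < x")
    case True
    then show ?thesis
      using x V_step[of w] l_next
      by (intro exI[of _ l] exI[of _ "x - Re (\<zeta> w)"]) (simp add: unpaste_def height_step w_neq_l P_def)
  next
    case no: False
    then show ?thesis
      using x by (intro exI[of _ \<alpha>] exI[of _ x]) (auto simp: unpaste_def hH P_def split: if_splits)
  qed
  then obtain \<beta> u where \<beta>: "unpaste (\<alpha>, x, h' \<alpha>) = (\<beta>, u, h \<beta>)" "0 \<le> u" "u \<le> Re (\<zeta> \<beta>)"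
    "P = Re (V (\<pi>b \<beta> - 1)) + u" by blast
  have "P \<le> Re Z" using base_position(3)[OF bot_bij \<beta>(2,3)] \<beta>(4) by simp
  then have x'w: "x' \<le> Re (\<zeta> \<alpha>')"
    using P' Re_Z x(4) by (cases "\<alpha>' = w") (simp_all del: Re_sum)
  then have "unpaste (\<alpha>', x', 0) = (\<alpha>', x', 0)" by (auto simp: unpaste_def)
  moreover have "glue \<pi>t \<pi>b \<zeta> (\<beta>, u, h \<beta>) (\<alpha>', x', 0)"
    by (rule glue.base) (use \<beta> x x'w P' in auto)
  ultimately show ?thesis using \<beta>(1) by auto
qed

text \<open>
  New neighbours are either old neighbours or arise from the two changes of the bottom row: the old
  right neighbour of \<open>l\<close> now follows \<open>w\<close>, whose right side now is the upper part of the right side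
  of \<open>l\<close>, and \<open>l\<close> follows the old last letter.  In the last case the new zipper is the old gluing
  at the last vertex.  If \<open>l\<close> was already last, both changes fall together.
\<close>

lemma unpaste_zip_bot:
  assumes succ: "\<pi>b' \<beta> = \<pi>b' \<alpha> + 1"
    and s: "0 \<le> s" "s \<le> - Im (vertex \<pi>b' \<zeta>' (\<pi>b' \<alpha>))" "s \<le> h' \<alpha>"
  shows "equivclp (glue \<pi>t \<pi>b \<zeta>) (unpaste (\<alpha>, Re (\<zeta>' \<alpha>), h' \<alpha> - s)) (unpaste (\<beta>, 0, h' \<beta> - s))"
proof -
  note succ' = bot_succ_step[OF succ]
  have "glue \<pi>t \<pi>b \<zeta> (unpaste (\<alpha>, Re (\<zeta>' \<alpha>), h' \<alpha> - s)) (\<beta>, 0, h' \<beta> - s)"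
  proof (cases "\<alpha> = w")
    case True
    have e: "unpaste (\<alpha>, Re (\<zeta>' \<alpha>), h' \<alpha> - s) = (l, Re (\<zeta> l), h l - s)"
      using width_pos[of l] w_neq_l by (simp add: True unpaste_simps height_step)
    have sV: "s \<le> - Im (V (\<pi>b l))" "s \<le> h l"
      using s bot_right_w height_w_less height_step[of w] w_neq_l by (simp_all add: True)
    show ?thesis
    proof (cases "\<beta> = l")
      case False
      then show ?thesis unfolding e using glue.zip_bot[of \<pi>b \<beta> l s \<zeta> \<pi>t] succ'(2)[OF True False] s(1) sV
        by (simp add: height_step)
    next
      case \<beta>: True
      have last: "\<pi>b l = CARD('a)" using succ'(3)[OF True \<beta>] .
      show ?thesis unfolding e \<beta>
        using glue.end_bot[of \<pi>t w \<pi>b l l s \<zeta>] last w_last l_next s(1) sV V_last sum_neg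
        by (simp add: height_step)
    qed
  next
    case False
    have e: "unpaste (\<alpha>, Re (\<zeta>' \<alpha>), h' \<alpha> - s) = (\<alpha>, Re (\<zeta> \<alpha>), h \<alpha> - s)"
      using succ'(1) False by (simp add: unpaste_simps height_step)
    have sV: "s \<le> - Im (V (\<pi>b \<alpha>))" "s \<le> h \<alpha>"
      using s bot_right[OF succ'(1) False] height_step[of \<alpha>] succ'(1) by simp_all
    show ?thesis
    proof (cases "\<beta> = l")
      case True
      show ?thesis unfolding e True
        using glue.end_bot[of \<pi>t w \<pi>b \<alpha> l s \<zeta>] succ'(4)[OF False True] w_last l_next s(1) sV V_last sum_neg
        by (simp add: height_step)
    next
      case \<beta>: False
      then show ?thesis unfolding e using glue.zip_bot[of \<pi>b \<beta> \<alpha> s \<zeta> \<pi>t] succ'(5)[OF False \<beta>] s(1) sV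
        by (simp add: height_step)
    qed
  qed
  then show ?thesis by (auto simp: unpaste_0)
qed

text \<open>
  The right side of the new rectangle of \<open>w\<close> is the upper part of the old right side of \<open>l\<close>, so this
  gluing is the part above the cut of the old zipper to the right of \<open>l\<close>.
\<close>

lemma unpaste_end_top:
  assumes \<beta>: "\<pi>t \<beta> = \<pi>t l + 1"
    and y: "0 \<le> y" "y \<le> Im (sum \<zeta>' UNIV)"
  shows "glue \<pi>t \<pi>b \<zeta> (unpaste (w, Re (\<zeta>' w), y)) (unpaste (\<beta>, 0, h' l + y))"
proof -
  have "unpaste (w, Re (\<zeta>' w), y) = (l, Re (\<zeta> l), y + (h l - h w))"
    using width_pos[of l] by (simp add: unpaste_simps)
  moreover have "y + (h l - h w) \<le> Im (U (\<pi>t l))"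
    using y(2) unfolding sum_step_UNIV height_l height_w by (simp add: U_step)
  moreover have "y + (h l - h w) \<le> h l"
  proof -
    have "Im (V (\<pi>b l)) \<le> 0"
      using V_nonpos[of "\<pi>b l"] bot_bounds[of l] V_last sum_neg by (cases "\<pi>b l = CARD('a)") auto
    then show ?thesis using y(2) unfolding sum_step_UNIV height_w by (simp add: V_l)
  qed
  ultimately show ?thesis
    using glue.zip_top[of \<pi>t \<beta> l "y + (h l - h w)" \<zeta> \<pi>b] \<beta> y(1) height_w_less
    by (simp add: unpaste_0 height_step add.commute[of _ y])
qed

text \<open>
  This gluing is the part of the old bottom zipper to the right of \<open>l\<close> which lies below the
  cut, hence the additional depth \<open>h w\<close>.  If \<open>l\<close> was already last, this zipper is replaced by the
  old gluing at the last vertex.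
\<close>

lemma unpaste_end_bot:
  assumes \<beta>: "\<pi>b' \<beta> = \<pi>b' w + 1"
    and s: "0 \<le> s" "s \<le> - Im (sum \<zeta>' UNIV)"
  shows "glue \<pi>t \<pi>b \<zeta> (unpaste (l, Re (\<zeta>' l), h' l - s)) (unpaste (\<beta>, 0, h' \<beta> - h' w - s))"
proof -
  note succ = bot_succ_step[OF \<beta>]
  have e: "unpaste (l, Re (\<zeta>' l), h' l - s) = (l, Re (\<zeta> l), h l - (h w + s))"
    using w_neq_l by (simp add: unpaste_simps height_step)
  have sV: "h w + s \<le> - Im (V (\<pi>b l))"
    using s(2) unfolding sum_step_UNIV height_w by (simp add: V_l)
  have "\<pi>t l < CARD('a)" using top_bounds[of l] top_eq_iff[of l w] w_last w_neq_l by auto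
  then have sh: "h w + s \<le> h l" using sV U_nonneg[of "\<pi>t l"] by (simp add: height_def)
  show ?thesis
  proof (cases "\<beta> = l")
    case False
    have "glue \<pi>t \<pi>b \<zeta> (l, Re (\<zeta> l), h l - (h w + s)) (\<beta>, 0, h \<beta> - (h w + s))"
      by (rule glue.zip_bot) (use succ(2)[OF refl False] sV sh s(1) height_pos[of w] in auto)
    moreover have "h' \<beta> - h' w - s = h \<beta> - (h w + s)" using False w_neq_l by (simp add: height_step)
    ultimately show ?thesis unfolding e unpaste_0 by metis
  next
    case True
    have last: "\<pi>b l = CARD('a)" using succ(3)[OF refl True] .
    have "glue \<pi>t \<pi>b \<zeta> (l, Re (\<zeta> l), h l - (h w + s)) (l, 0, h l - h w - (h w + s))"
      by (rule glue.end_bot) (use last w_last l_next sV s(1) height_pos[of w] V_last sum_neg in auto)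
    moreover have "h' \<beta> - h' w - s = h l - h w - (h w + s)" using True w_neq_l by (simp add: height_step)
    ultimately show ?thesis unfolding e unpaste_0 True by metis
  qed
qed

lemma unpaste_glue:
  assumes "glue \<pi>t \<pi>b' \<zeta>' p q"
  shows "equivclp (glue \<pi>t \<pi>b \<zeta>) (unpaste p) (unpaste q)"
  using assms
proof cases
  case (base x \<alpha> x' \<alpha>')
  show ?thesis unfolding base(1,2) by (rule unpaste_base) (use base in auto)
next
  case (zip_top \<beta> \<alpha> y)
  have nw: "\<alpha> \<noteq> w" using zip_top(3) top_bounds(2)[of \<beta>] w_last by auto
  have "glue \<pi>t \<pi>b \<zeta> (\<alpha>, Re (\<zeta> \<alpha>), y) (\<beta>, 0, y)"
    by (rule glue.zip_top)
      (use zip_top top_right[OF nw] height_step[of \<alpha>] height_pos[of w] in \<open>auto split: if_splits\<close>)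
  then show ?thesis using nw by (auto simp: zip_top(1,2) unpaste_simps(1) unpaste_0)
next
  case (zip_bot \<beta> \<alpha> s)
  show ?thesis unfolding zip_bot(1,2) by (rule unpaste_zip_bot) (use zip_bot in auto)
next
  case (end_top \<alpha> \<beta> \<beta>' y)
  have "\<alpha> = w" "\<beta> = l"
    using end_top(3,4) w_last top_eq_iff bot_l position_eq_iff[OF bot_bij'] by metis+
  then show ?thesis using unpaste_end_top[of \<beta>' y] end_top by auto
next
  case (end_bot \<alpha> \<beta> \<alpha>' s)
  have "\<alpha> = w" "\<beta> = l"
    using end_bot(3,4) w_last top_eq_iff bot_l position_eq_iff[OF bot_bij'] by metis+
  then show ?thesis using unpaste_end_bot[of \<alpha>' s] end_bot by auto
qed

lemma top_step_connection:
  assumes "has_horizontal_connection \<pi>t \<pi>b' \<zeta>'"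
  shows "has_horizontal_connection \<pi>t \<pi>b \<zeta>"
proof (rule connection_transfer[where \<phi> = unpaste, OF suspension_step suspension_axioms
      unpaste_rectangles unpaste_glue unpaste_vertex_point _ _ assms])
  fix \<alpha> x y assume p: "(\<alpha>, x, y) \<in> rectangles \<pi>t \<pi>b' \<zeta>'"
  show "\<exists>\<epsilon>>0. \<exists>\<beta> u v. \<forall>s\<in>{0..\<epsilon>}. (\<beta>, u + s, v) \<in> rectangles \<pi>t \<pi>b \<zeta> \<and>
      equivclp (glue \<pi>t \<pi>b \<zeta>) (unpaste (\<alpha>, x + s, y)) (\<beta>, u + s, v)" if x: "x < Re (\<zeta>' \<alpha>)"
  proof (cases "\<alpha> = w \<and> Re (\<zeta> w) \<le> x")
    \<comment> \<open>From the seam on, the motion continues in the rectangle of \<open>l\<close>.\<close>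
    case True
    have y: "0 \<le> y" "y \<le> h w" using p True w_neq_l by (auto simp: rectangles_iff height_step)
    have "(l, x - Re (\<zeta> w) + s, y + (h l - h w)) \<in> rectangles \<pi>t \<pi>b \<zeta> \<and>
        equivclp (glue \<pi>t \<pi>b \<zeta>) (unpaste (\<alpha>, x + s, y)) (l, x - Re (\<zeta> w) + s, y + (h l - h w))"
      if s: "s \<in> {0..Re (\<zeta>' w) - x}" for s
    proof
      show "(l, x - Re (\<zeta> w) + s, y + (h l - h w)) \<in> rectangles \<pi>t \<pi>b \<zeta>"
        using s True y height_w_less by (simp add: rectangles_iff)
      show "equivclp (glue \<pi>t \<pi>b \<zeta>) (unpaste (\<alpha>, x + s, y)) (l, x - Re (\<zeta> w) + s, y + (h l - h w))"
      proof (cases "x + s = Re (\<zeta> w)")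
        case seam_point: True
        then have z: "x - Re (\<zeta> w) + s = 0" by simp
        show ?thesis unfolding z using seam[OF y] True seam_point by (auto simp: unpaste_simps)
      next
        case False
        then have "unpaste (\<alpha>, x + s, y) = (l, x - Re (\<zeta> w) + s, y + (h l - h w))"
          using True s by (simp add: unpaste_def)
        then show ?thesis by simp
      qed
    qed
    moreover have "Re (\<zeta>' w) - x > 0" using x True by simp
    ultimately show ?thesis by blast
  next
    case False
    \<comment> \<open>Up to the seam, or up to the right side of a rectangle which is not cut.\<close>
    have "(\<alpha>, x + s, y) \<in> rectangles \<pi>t \<pi>b \<zeta> \<and>
        equivclp (glue \<pi>t \<pi>b \<zeta>) (unpaste (\<alpha>, x + s, y)) (\<alpha>, x + s, y)"
      if s: "s \<in> {0..Re (\<zeta> \<alpha>) - x}" for s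
      using p s height_pos[of w] by (auto simp: unpaste_def rectangles_iff height_step split: if_splits)
    moreover have "Re (\<zeta> \<alpha>) - x > 0" using x False by (auto split: if_splits)
    ultimately show ?thesis by blast
  qed
  show "\<exists>\<epsilon>>0. \<exists>\<beta> u v. \<forall>s\<in>{0..\<epsilon>}. (\<beta>, u - s, v) \<in> rectangles \<pi>t \<pi>b \<zeta> \<and>
      equivclp (glue \<pi>t \<pi>b \<zeta>) (unpaste (\<alpha>, x - s, y)) (\<beta>, u - s, v)" if x: "0 < x"
  proof (cases "\<alpha> = w \<and> Re (\<zeta> w) < x")
    case True
    have y: "0 \<le> y" "y \<le> h w" using p True w_neq_l by (auto simp: rectangles_iff height_step)
    have "(l, x - Re (\<zeta> w) - s, y + (h l - h w)) \<in> rectangles \<pi>t \<pi>b \<zeta> \<and>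
        equivclp (glue \<pi>t \<pi>b \<zeta>) (unpaste (\<alpha>, x - s, y)) (l, x - Re (\<zeta> w) - s, y + (h l - h w))"
      if s: "s \<in> {0..x - Re (\<zeta> w)}" for s
    proof
      show "(l, x - Re (\<zeta> w) - s, y + (h l - h w)) \<in> rectangles \<pi>t \<pi>b \<zeta>"
        using s p True y height_w_less by (simp add: rectangles_iff)
      show "equivclp (glue \<pi>t \<pi>b \<zeta>) (unpaste (\<alpha>, x - s, y)) (l, x - Re (\<zeta> w) - s, y + (h l - h w))"
      proof (cases "x - s = Re (\<zeta> w)")
        case seam_point: True
        then have z: "x - Re (\<zeta> w) - s = 0" by simp
        show ?thesis unfolding z using seam[OF y] True seam_point by (auto simp: unpaste_simps)
      next
        case False
        then have "unpaste (\<alpha>, x - s, y) = (l, x - Re (\<zeta> w) - s, y + (h l - h w))"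
          using True s by (simp add: unpaste_def)
        then show ?thesis by simp
      qed
    qed
    moreover have "x - Re (\<zeta> w) > 0" using True by simp
    ultimately show ?thesis by blast
  next
    case False
    have "(\<alpha>, x - s, y) \<in> rectangles \<pi>t \<pi>b \<zeta> \<and>
        equivclp (glue \<pi>t \<pi>b \<zeta>) (unpaste (\<alpha>, x - s, y)) (\<alpha>, x - s, y)"
      if s: "s \<in> {0..x}" for s
      using p s False height_pos[of w] by (auto simp: unpaste_def rectangles_iff height_step split: if_splits)
    then show ?thesis using x by blast
  qed
qed

end


section \<open>Surfaces without horizontal connection\<close>

context suspension
begin

text \<open>
  In this case the base segment itself joins \<open>U\<^sub>0\<close> to \<open>U\<^sub>d\<close>.
\<close>

lemma zero_sum_connection:
  assumes "Im Z = 0"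
  shows "has_horizontal_connection \<pi>t \<pi>b \<zeta>"
proof (rule row_connection[of 0 "CARD('a)" 0])
  show "Im (U CARD('a)) = 0" using assms by (simp add: U_last)
qed (use U_0 top_pos two_letters height_pos in \<open>auto intro: less_imp_le\<close>)

lemma last_top_not_last_bot:
  assumes "\<pi>t \<alpha> = CARD('a)"
  shows "\<pi>b \<alpha> < CARD('a)"
proof (rule ccontr)
  assume "\<not> \<pi>b \<alpha> < CARD('a)"
  then have "\<pi>b \<alpha> = CARD('a)" using bot_bounds(2)[of \<alpha>] by simp
  then have "U (CARD('a) - 1) = V (CARD('a) - 1)"
    using U_step[of \<alpha>] V_step[of \<alpha>] U_last V_last assms by simp
  then show False using top_pos[of "CARD('a) - 1"] bot_neg[of "CARD('a) - 1"] two_letters by force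
qed

text \<open>
  Take a maximal block of letters of \<open>C\<close> in the top row.  Its neighbours have height less than
  \<open>\<epsilon>\<close>, so the vertices at its two ends are less than \<open>\<epsilon>\<close> above the base.  The differences of the
  heights of vertices within the block are sums over subsets of \<open>C\<close>: by the gap at \<open>0\<close> the
  end points have the same height and no vertex in between is lower.  The segment to the next vertex at
  this height is a connection.  The last letter of the top row is excluded because the vertex
  \<open>U\<^sub>d\<close> is below the base.
\<close>

lemma small_heights_connection:
  assumes neg: "Im Z < 0" and \<epsilon>: "0 < \<epsilon>"
    and C: "c \<in> C" "\<And>\<alpha>. \<alpha> \<in> C \<Longrightarrow> \<pi>t \<alpha> \<noteq> CARD('a)"
    and gap: "\<And>X. X \<subseteq> C \<Longrightarrow> (\<Sum>\<alpha>\<in>X. Im (\<zeta> \<alpha>)) = 0 \<or> \<epsilon> \<le> \<bar>\<Sum>\<alpha>\<in>X. Im (\<zeta> \<alpha>)\<bar>"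
    and small: "\<And>\<beta>. \<beta> \<notin> C \<Longrightarrow> h \<beta> < \<epsilon>"
  shows "has_horizontal_connection \<pi>t \<pi>b \<zeta>"
proof -
  have V_le: "Im (V k) \<le> 0" if "k \<le> CARD('a)" for k
    using that V_nonpos[of k] V_last neg by (cases "k = CARD('a)") auto
  \<comment> \<open>The block of \<open>c\<close> occupies the places \<open>m + 1, \<dots>, r - 1\<close>; \<open>m = 0\<close> if nothing precedes it.\<close>
  define p where "p = \<pi>t c"
  have p: "1 \<le> p" "p < CARD('a)" using top_bounds[of c] C by (auto simp: p_def le_neq_implies_less)
  define M where "M = insert 0 {\<pi>t \<beta> |\<beta>. \<beta> \<notin> C \<and> \<pi>t \<beta> < p}"
  define m where "m = Max M"
  have fin: "finite M" by (simp add: M_def)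
  have mM: "m \<in> M" unfolding m_def by (rule Max_in) (use fin in \<open>auto simp: M_def\<close>)
  have mp: "m < p" using mM p by (auto simp: M_def)
  define r where "r = (LEAST k. \<exists>\<beta>. \<beta> \<notin> C \<and> p < k \<and> \<pi>t \<beta> = k)"
  have "\<exists>\<beta>. \<beta> \<notin> C \<and> p < CARD('a) \<and> \<pi>t \<beta> = CARD('a)"
    using letter_at[OF top_bij, of "CARD('a)"] C(2) p by (metis le_refl less_imp_le order_trans)
  then have ex: "\<exists>\<beta>. \<beta> \<notin> C \<and> p < r \<and> \<pi>t \<beta> = r" unfolding r_def by (rule LeastI)
  then obtain \<beta>r where r: "\<beta>r \<notin> C" "p < r" "\<pi>t \<beta>r = r" by blast
  have r_le: "r \<le> CARD('a)" using r(3) top_bounds(2) by auto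
  have block: "\<alpha> \<in> C" if "m < \<pi>t \<alpha>" "\<pi>t \<alpha> < r" for \<alpha>
  proof (rule ccontr)
    assume \<alpha>: "\<alpha> \<notin> C"
    then have "\<pi>t \<alpha> \<noteq> p" using top_eq_iff[of \<alpha> c] C(1) by (auto simp: p_def)
    moreover have "\<not> \<pi>t \<alpha> < p"
    proof
      assume "\<pi>t \<alpha> < p"
      then have "\<pi>t \<alpha> \<le> m" unfolding m_def using \<alpha> by (intro Max_ge fin) (auto simp: M_def)
      then show False using that(1) by simp
    qed
    moreover have "\<not> p < \<pi>t \<alpha>"
      using not_less_Least[of "\<pi>t \<alpha>" "\<lambda>k. \<exists>\<beta>. \<beta> \<notin> C \<and> p < k \<and> \<pi>t \<beta> = k"] that(2) \<alpha>
      unfolding r_def[symmetric] by blast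
    ultimately show False by simp
  qed
  have gap': "Im (U k) = Im (U m) \<or> \<epsilon> \<le> \<bar>Im (U k) - Im (U m)\<bar>" if "m \<le> k" "k < r" for k
  proof -
    have "Im (U k) - Im (U m) = (\<Sum>\<alpha> | m < \<pi>t \<alpha> \<and> \<pi>t \<alpha> \<le> k. Im (\<zeta> \<alpha>))"
      using arg_cong[OF vertex_diff[OF that(1), of \<pi>t \<zeta>], of Im] by simp
    moreover have "{\<alpha>. m < \<pi>t \<alpha> \<and> \<pi>t \<alpha> \<le> k} \<subseteq> C" using block that(2) by auto
    ultimately show ?thesis using gap[of "{\<alpha>. m < \<pi>t \<alpha> \<and> \<pi>t \<alpha> \<le> k}"] by linarith
  qed
  have m_small: "Im (U m) < \<epsilon>"
  proof (cases "m = 0")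
    case False
    then obtain \<beta> where \<beta>: "\<beta> \<notin> C" "m = \<pi>t \<beta>" using mM by (auto simp: M_def)
    then show ?thesis using small[OF \<beta>(1)] V_le[of "\<pi>b \<beta>"] bot_bounds(2)[of \<beta>] by (simp add: height_def)
  qed (use U_0 \<epsilon> in simp)
  have r_small: "Im (U (r - 1)) < \<epsilon>"
  proof -
    have "Im (V (\<pi>b \<beta>r - 1)) \<le> 0" by (rule V_le) (use bot_bounds(2)[of \<beta>r] in simp)
    then show ?thesis using small[OF r(1)] r(3) by (simp add: height_left)
  qed
  have m0: "0 \<le> Im (U m)" using U_nonneg[of m] mp p by simp
  have above: "Im (U m) \<le> Im (U k)" if "m \<le> k" "k < r" for k
  proof -
    have "0 \<le> Im (U k)" by (rule U_nonneg) (use that(2) r_le in simp)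
    then show ?thesis using gap'[OF that] m_small by linarith
  qed
  have "Im (U (r - 1)) = Im (U m)"
  proof -
    have "m \<le> r - 1" "r - 1 < r" using mp r(2) by simp_all
    then show ?thesis using gap'[of "r - 1"] above[of "r - 1"] r_small m0 by linarith
  qed
  then have ex_q: "m < r - 1 \<and> Im (U (r - 1)) = Im (U m)" using mp r(2) by simp
  define q where "q = (LEAST k. m < k \<and> Im (U k) = Im (U m))"
  have q: "m < q" "Im (U q) = Im (U m)"
    using LeastI[of "\<lambda>k. m < k \<and> Im (U k) = Im (U m)", OF ex_q] by (auto simp: q_def)
  have qr: "q \<le> r - 1" unfolding q_def by (rule Least_le) (rule ex_q)
  show ?thesis
  proof (rule row_connection[OF q(1) _ refl q(2)])
    show "q \<le> CARD('a)" using qr r_le by simp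
    fix k assume k: "m < k" "k < q"
    have "Im (U k) \<noteq> Im (U m)"
      using not_less_Least[of k "\<lambda>k. m < k \<and> Im (U k) = Im (U m)"] k by (auto simp: q_def)
    moreover have "m \<le> k" "k < r" using k qr by simp_all
    ultimately show "Im (U m) < Im (U k)" using above[of k] by simp
  next
    fix \<alpha> assume \<alpha>: "m < \<pi>t \<alpha>" "\<pi>t \<alpha> \<le> q"
    have "m \<le> \<pi>t \<alpha> - 1" "\<pi>t \<alpha> - 1 < r" using \<alpha> qr r(2) by linarith+
    then have "Im (U m) \<le> Im (U (\<pi>t \<alpha> - 1))" by (rule above)
    moreover have "Im (V (\<pi>b \<alpha> - 1)) \<le> 0" by (rule V_le) (use bot_bounds(2)[of \<alpha>] in simp)
    ultimately show "Im (U m) \<le> h \<alpha>" by (simp add: height_left)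
  qed
qed

end

lemma cnj_cnj_comp: "cnj \<circ> (cnj \<circ> \<zeta>) = \<zeta>"
  by (simp add: fun_eq_iff)

lemma suspension_swap_connection:
  assumes "suspension \<pi>t \<pi>b \<zeta>"
  shows "has_horizontal_connection \<pi>b \<pi>t (cnj \<circ> \<zeta>) \<longleftrightarrow> has_horizontal_connection \<pi>t \<pi>b \<zeta>"
  using suspension.swap_connection[OF assms] suspension.swap_connection[OF suspension.swap[OF assms]]
  by (auto simp: cnj_cnj_comp)

text \<open>
  A horizontal connection after the step would be one of the surface before it, since the two surfaces
  differ by cutting and pasting; so the absence of connections is inherited and the step can be repeated.
\<close>

lemma backward_step_defined:
  fixes \<pi>t \<pi>b :: "'a::finite \<Rightarrow> nat"
  assumes S: "suspension \<pi>t \<pi>b \<zeta>" and nc: "\<not> has_horizontal_connection \<pi>t \<pi>b \<zeta>"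
  shows "\<exists>a \<pi>t' \<pi>b' \<zeta>'. backward_step (\<pi>t, \<pi>b, \<zeta>) = Some (a, \<pi>t', \<pi>b', \<zeta>') \<and>
    suspension \<pi>t' \<pi>b' \<zeta>' \<and> \<not> has_horizontal_connection \<pi>t' \<pi>b' \<zeta>' \<and>
    \<zeta>' = \<zeta>(winner a := \<zeta> (winner a) + \<zeta> (loser a)) \<and>
    height \<pi>t' \<pi>b' \<zeta>' = (height \<pi>t \<pi>b \<zeta>)
      (loser a := height \<pi>t \<pi>b \<zeta> (loser a) - height \<pi>t \<pi>b \<zeta> (winner a)) \<and>
    (Im (\<Sum>\<alpha>\<in>UNIV. \<zeta> \<alpha>) < 0 \<and> \<pi>t (winner a) = CARD('a) \<or>
     Im (\<Sum>\<alpha>\<in>UNIV. \<zeta> \<alpha>) > 0 \<and> \<pi>b (winner a) = CARD('a))"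
proof -
  interpret S: suspension \<pi>t \<pi>b \<zeta> by (fact S)
  have d: "1 \<le> CARD('a)" using S.two_letters by simp
  consider "Im S.Z < 0" | "Im S.Z > 0" using S.zero_sum_connection nc by fastforce
  then show ?thesis
  proof cases
    case 1
    define w where "w = letter \<pi>t CARD('a)"
    define l where "l = letter \<pi>b (\<pi>b w + 1)"
    have w: "\<pi>t w = CARD('a)" using letter_at[OF S.top_bij d] by (simp add: w_def)
    have l: "\<pi>b l = \<pi>b w + 1"
      using letter_at[OF S.bot_bij, of "\<pi>b w + 1"] S.last_top_not_last_bot[OF w] by (simp add: l_def)
    interpret T: top_step \<pi>t \<pi>b \<zeta> w l by unfold_locales (use w l 1 in auto)
    let ?a = "\<lparr>source = (\<pi>t, T.\<pi>b'), target = (\<pi>t, \<pi>b), winner = w, loser = l\<rparr>"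
    have st: "backward_step (\<pi>t, \<pi>b, \<zeta>) = Some (?a, \<pi>t, T.\<pi>b', T.\<zeta>')"
      using 1 by (simp add: Let_def w_def l_def)
    have ht: "T.h' = S.h(l := S.h l - S.h w)" using T.height_step by auto
    have nc': "\<not> has_horizontal_connection \<pi>t T.\<pi>b' T.\<zeta>'" using T.top_step_connection nc by blast
    show ?thesis
      by (intro exI[of _ ?a] exI[of _ \<pi>t] exI[of _ T.\<pi>b'] exI[of _ T.\<zeta>'] conjI st nc' T.suspension_step)
        (use 1 w ht in simp_all)
  next
    case 2
    define w where "w = letter \<pi>b CARD('a)"
    define l where "l = letter \<pi>t (\<pi>t w + 1)"
    interpret R: suspension \<pi>b \<pi>t "cnj \<circ> \<zeta>" by (rule S.swap)
    have w: "\<pi>b w = CARD('a)" using letter_at[OF S.bot_bij d] by (simp add: w_def)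
    have l: "\<pi>t l = \<pi>t w + 1"
      using letter_at[OF S.top_bij, of "\<pi>t w + 1"] R.last_top_not_last_bot[OF w] by (simp add: l_def)
    interpret T: top_step \<pi>b \<pi>t "cnj \<circ> \<zeta>" w l
      by unfold_locales (use w l 2 in \<open>auto simp: sum_negf\<close>)
    let ?\<pi>t' = "move_last l \<pi>t" and ?\<zeta>' = "\<zeta>(w := \<zeta> w + \<zeta> l)"
    have z: "T.\<zeta>' = cnj \<circ> ?\<zeta>'" by (auto simp: fun_eq_iff)
    have S': "suspension ?\<pi>t' \<pi>b ?\<zeta>'"
      using suspension.swap[OF T.suspension_step] unfolding z cnj_cnj_comp .
    have nc': "\<not> has_horizontal_connection ?\<pi>t' \<pi>b ?\<zeta>'"
      using T.top_step_connection nc suspension_swap_connection[OF S] suspension_swap_connection[OF S']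
      unfolding z by blast
    have "height ?\<pi>t' \<pi>b ?\<zeta>' = T.h'"
      using suspension.height_swap[OF S'] unfolding z by simp
    then have ht: "height ?\<pi>t' \<pi>b ?\<zeta>' = S.h(l := S.h l - S.h w)"
      using T.height_step S.height_swap by (auto simp: fun_eq_iff)
    let ?a = "\<lparr>source = (?\<pi>t', \<pi>b), target = (\<pi>t, \<pi>b), winner = w, loser = l\<rparr>"
    have st: "backward_step (\<pi>t, \<pi>b, \<zeta>) = Some (?a, ?\<pi>t', \<pi>b, ?\<zeta>')"
      using 2 by (simp add: Let_def w_def l_def)
    show ?thesis
      by (intro exI[of _ ?a] exI[of _ ?\<pi>t'] exI[of _ \<pi>b] exI[of _ ?\<zeta>'] conjI st nc' S')
        (use 2 w ht in simp_all)
  qed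
qed


section \<open>Letters that win infinitely often\<close>

text \<open>
  The sum of all heights stays positive and decreases in each step by the height of the winner, so the
  heights of the winners tend to \<open>0\<close>; and no single height ever increases.
\<close>

lemma frequent_winner_vanishes:
  fixes H :: "nat \<Rightarrow> 'a::finite \<Rightarrow> real" and w l :: "nat \<Rightarrow> 'a"
  assumes pos: "\<And>n \<alpha>. 0 < H n \<alpha>"
    and step: "\<And>n. H (Suc n) = (H n)(l n := H n (l n) - H n (w n))"
    and inf: "\<And>N. \<exists>n\<ge>N. w n = \<beta>" and \<epsilon>: "0 < \<epsilon>"
  shows "\<exists>N. \<forall>n\<ge>N. H n \<beta> < \<epsilon>"
proof -
  define T where "T n = (\<Sum>\<alpha>\<in>UNIV. H n \<alpha>)" for n
  have T_step: "T (Suc n) = T n - H n (w n)" for n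
  proof -
    have "H (Suc n) = (\<lambda>\<alpha>. H n \<alpha> - (if \<alpha> = l n then H n (w n) else 0))"
      by (auto simp: step)
    then show ?thesis unfolding T_def by (simp only: sum_subtractf) (simp add: sum.delta)
  qed
  have "decseq T" by (rule decseq_SucI) (simp add: T_step less_imp_le pos)
  moreover have "0 \<le> T n" for n unfolding T_def by (intro sum_nonneg) (simp add: less_imp_le pos)
  ultimately obtain L where "T \<longlonglongrightarrow> L" using decseq_convergent by metis
  then have "(\<lambda>n. T n - T (Suc n)) \<longlonglongrightarrow> L - L"
    by (intro tendsto_diff LIMSEQ_Suc)
  then have "(\<lambda>n. H n (w n)) \<longlonglongrightarrow> 0" by (simp add: T_step)
  then have "eventually (\<lambda>n. H n (w n) < \<epsilon>) sequentially"
    using \<epsilon> by (rule order_tendstoD)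
  then obtain N where N: "\<And>n. n \<ge> N \<Longrightarrow> H n (w n) < \<epsilon>" by (auto simp: eventually_sequentially)
  obtain k where k: "k \<ge> N" "w k = \<beta>" using inf by blast
  have "decseq (\<lambda>n. H n \<beta>)" by (rule decseq_SucI) (simp add: step less_imp_le pos)
  then have "H n \<beta> \<le> H k \<beta>" if "n \<ge> k" for n using that by (rule decseqD)
  then show ?thesis using N[OF k(1)] k(2) by (metis le_less_trans)
qed

text \<open>
  By finiteness of the alphabet, from each place on a complete block can be read off; the blocks are
  chosen one after the other.
\<close>

lemma infinitely_completeI:
  fixes \<gamma> :: "nat \<Rightarrow> 'a::finite arrow"
  assumes "\<And>\<alpha> N. \<exists>n\<ge>N. winner (\<gamma> n) = \<alpha>"
  shows "infinitely_complete \<gamma>"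
proof -
  have "\<exists>K>N. \<forall>\<alpha>. \<exists>n. N \<le> n \<and> n < K \<and> winner (\<gamma> n) = \<alpha>" for N
  proof -
    obtain f where f: "\<And>\<alpha>. N \<le> f \<alpha> \<and> winner (\<gamma> (f \<alpha>)) = \<alpha>" using assms by metis
    have "f \<alpha> \<le> Max (range f)" for \<alpha> by simp
    then have "N \<le> f \<alpha> \<and> f \<alpha> < Suc (max N (Max (range f))) \<and> winner (\<gamma> (f \<alpha>)) = \<alpha>" for \<alpha>
      using f[of \<alpha>] by (simp add: less_Suc_eq_le le_max_iff_disj)
    then show ?thesis by (intro exI[of _ "Suc (max N (Max (range f)))"]) auto
  qed
  then obtain K where K: "\<And>N. K N > N" "\<And>N \<alpha>. \<exists>n. N \<le> n \<and> n < K N \<and> winner (\<gamma> n) = \<alpha>" by metis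
  define k where "k = rec_nat 0 (\<lambda>_. K)"
  have k: "k 0 = 0" "k (Suc j) = K (k j)" for j by (simp_all add: k_def)
  show ?thesis unfolding infinitely_complete_def
  proof (intro exI[of _ k] conjI allI)
    show "strict_mono k" by (simp add: strict_mono_Suc_iff k K)
    show "complete_path (map \<gamma> (rev [k j..<k (Suc j)]))" for j
      unfolding complete_path_def k using K(2)[of "k j"] by simp (metis atLeastLessThan_iff imageI)
  qed (rule k)
qed


section \<open>The backward rotation number\<close>

text \<open>Both types of the step are covered, as the reflection preserves the heights and the gap.\<close>

lemma small_heights_connection_winner:
  fixes \<pi>t \<pi>b :: "'a::finite \<Rightarrow> nat"
  assumes S: "suspension \<pi>t \<pi>b \<zeta>"
    and w: "Im (\<Sum>\<alpha>\<in>UNIV. \<zeta> \<alpha>) < 0 \<and> \<pi>t w = CARD('a) \<or> Im (\<Sum>\<alpha>\<in>UNIV. \<zeta> \<alpha>) > 0 \<and> \<pi>b w = CARD('a)"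
    and \<epsilon>: "0 < \<epsilon>" and C: "c \<in> C" "w \<notin> C"
    and gap: "\<And>X. X \<subseteq> C \<Longrightarrow> (\<Sum>\<alpha>\<in>X. Im (\<zeta> \<alpha>)) = 0 \<or> \<epsilon> \<le> \<bar>\<Sum>\<alpha>\<in>X. Im (\<zeta> \<alpha>)\<bar>"
    and small: "\<And>\<beta>. \<beta> \<notin> C \<Longrightarrow> height \<pi>t \<pi>b \<zeta> \<beta> < \<epsilon>"
  shows "has_horizontal_connection \<pi>t \<pi>b \<zeta>"
  using w
proof
  interpret S: suspension \<pi>t \<pi>b \<zeta> by (fact S)
  assume "Im S.Z < 0 \<and> \<pi>t w = CARD('a)"
  moreover from this have "\<pi>t \<alpha> \<noteq> CARD('a)" if "\<alpha> \<in> C" for \<alpha>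
    using S.top_eq_iff[of \<alpha> w] C(2) that by auto
  ultimately show ?thesis by (intro S.small_heights_connection[OF _ \<epsilon> C(1) _ gap small]) auto
next
  interpret S: suspension \<pi>t \<pi>b \<zeta> by (fact S)
  interpret R: suspension \<pi>b \<pi>t "cnj \<circ> \<zeta>" by (rule S.swap)
  assume "Im S.Z > 0 \<and> \<pi>b w = CARD('a)"
  then have "Im R.Z < 0" "\<pi>b \<alpha> \<noteq> CARD('a)" if "\<alpha> \<in> C" for \<alpha>
    using S.bot_eq_iff[of \<alpha> w] C(2) that by (auto simp: sum_negf)
  then have "has_horizontal_connection \<pi>b \<pi>t (cnj \<circ> \<zeta>)"
    by (rule R.small_heights_connection[OF _ \<epsilon> C(1)])
      (use C(1) gap small S.height_swap in \<open>auto simp: sum_negf\<close>)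
  then show ?thesis by (simp only: suspension_swap_connection[OF S])
qed

lemma suspension_zeta:
  fixes \<pi>t \<pi>b :: "'a::finite \<Rightarrow> nat"
  assumes "CARD('a) \<ge> 2" "irreducible_pair \<pi>t \<pi>b" "\<forall>\<alpha>. lam \<alpha> > 0" "\<tau> \<in> Theta \<pi>t \<pi>b"
  shows "suspension \<pi>t \<pi>b (zeta lam \<tau>)"
proof
  fix k assume k: "1 \<le> k" "k < CARD('a)"
  have "Im (vertex p (zeta lam \<tau>) k) = (\<Sum>\<alpha> | p \<alpha> < Suc k. \<tau> \<alpha>)" for p
    by (simp add: vertex_def zeta_def less_Suc_eq_le)
  then show "0 < Im (vertex \<pi>t (zeta lam \<tau>) k)" "Im (vertex \<pi>b (zeta lam \<tau>) k) < 0"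
    using assms(4) k by (auto simp: Theta_def)
qed (use assms in \<open>auto simp: irreducible_pair_def zeta_def\<close>)

theorem proposition4p3:
  fixes \<pi>t \<pi>b :: "'a::finite \<Rightarrow> nat" and lam \<tau> :: "'a \<Rightarrow> real"
  assumes "CARD('a) \<ge> 2"
    and "irreducible_pair \<pi>t \<pi>b"
    and "\<forall>\<alpha>. lam \<alpha> > 0"
    and "\<tau> \<in> Theta \<pi>t \<pi>b"
    and "\<not> has_horizontal_connection \<pi>t \<pi>b (zeta lam \<tau>)"
  shows "\<exists>\<gamma>. backward_rotation_number \<pi>t \<pi>b (zeta lam \<tau>) \<gamma> \<and> infinitely_complete \<gamma>"
proof -
  define good :: "'a rv_state \<Rightarrow> bool" where
    "good = (\<lambda>(\<pi>t, \<pi>b, \<zeta>). suspension \<pi>t \<pi>b \<zeta> \<and> \<not> has_horizontal_connection \<pi>t \<pi>b \<zeta>)"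
  define next_state where "next_state s = snd (the (backward_step s))" for s :: "'a rv_state"
  define S where "S n = (next_state ^^ n) (\<pi>t, \<pi>b, zeta lam \<tau>)" for n
  define \<gamma> where "\<gamma> n = fst (the (backward_step (S n)))" for n
  have S_0: "S 0 = (\<pi>t, \<pi>b, zeta lam \<tau>)" by (simp add: S_def)
  have S_Suc: "S (Suc n) = next_state (S n)" for n by (simp add: S_def)
  define p where "p n = fst (S n)" for n
  define q where "q n = fst (snd (S n))" for n
  define \<zeta> where "\<zeta> n = snd (snd (S n))" for n
  have S_eq: "S n = (p n, q n, \<zeta> n)" for n by (simp add: p_def q_def \<zeta>_def)
  define w where "w n = winner (\<gamma> n)" for n
  define l where "l n = loser (\<gamma> n)" for n
  define H where "H n = height (p n) (q n) (\<zeta> n)" for n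
  have step: "backward_step (S n) = Some (\<gamma> n, S (Suc n)) \<and> good (S (Suc n)) \<and>
      \<zeta> (Suc n) = (\<zeta> n)(w n := \<zeta> n (w n) + \<zeta> n (l n)) \<and>
      H (Suc n) = (H n)(l n := H n (l n) - H n (w n)) \<and>
      (Im (\<Sum>\<alpha>\<in>UNIV. \<zeta> n \<alpha>) < 0 \<and> p n (w n) = CARD('a) \<or>
       Im (\<Sum>\<alpha>\<in>UNIV. \<zeta> n \<alpha>) > 0 \<and> q n (w n) = CARD('a))"
    if "good (S n)" for n
  proof -
    have "suspension (p n) (q n) (\<zeta> n)" "\<not> has_horizontal_connection (p n) (q n) (\<zeta> n)"
      using that S_eq[of n] by (simp_all add: good_def)
    note ex = backward_step_defined[OF this, folded H_def]
    obtain a pt' pb' z' where st: "backward_step (p n, q n, \<zeta> n) = Some (a, pt', pb', z')" and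
      props: "suspension pt' pb' z'" "\<not> has_horizontal_connection pt' pb' z'"
        "z' = (\<zeta> n)(winner a := \<zeta> n (winner a) + \<zeta> n (loser a))"
        "height pt' pb' z' = (H n)(loser a := H n (loser a) - H n (winner a))"
        "Im (\<Sum>\<alpha>\<in>UNIV. \<zeta> n \<alpha>) < 0 \<and> p n (winner a) = CARD('a) \<or>
         Im (\<Sum>\<alpha>\<in>UNIV. \<zeta> n \<alpha>) > 0 \<and> q n (winner a) = CARD('a)"
      using ex by blast
    have a: "a = \<gamma> n" "S (Suc n) = (pt', pb', z')"
      using st unfolding \<gamma>_def S_Suc next_state_def S_eq[of n] by auto
    then have "p (Suc n) = pt'" "q (Suc n) = pb'" "\<zeta> (Suc n) = z'"
      by (simp_all add: p_def q_def \<zeta>_def)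
    then show ?thesis using st props a unfolding S_eq[of n]
      by (simp only: good_def w_def l_def H_def[of "Suc n"] case_prod_conv simp_thms)
  qed
  have good: "good (S n)" for n
  proof (induction n)
    case 0
    show ?case unfolding S_0 good_def using suspension_zeta[OF assms(1-4)] assms(5) by simp
  qed (use step in blast)
  have susp: "suspension (p n) (q n) (\<zeta> n)" and nc: "\<not> has_horizontal_connection (p n) (q n) (\<zeta> n)" for n
    using good[of n] S_eq[of n] by (auto simp: good_def)
  have H_pos: "0 < H n \<alpha>" for n \<alpha> unfolding H_def by (rule suspension.height_pos[OF susp])
  have H_step: "H (Suc n) = (H n)(l n := H n (l n) - H n (w n))" for n using step[OF good] by blast
  have \<zeta>_step: "\<zeta> (Suc n) = (\<zeta> n)(w n := \<zeta> n (w n) + \<zeta> n (l n))" for n using step[OF good] by blast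
  define C where "C = {\<alpha>. \<exists>N. \<forall>n\<ge>N. w n \<noteq> \<alpha>}"
  have "C = {}"
  proof (rule ccontr)
    assume "C \<noteq> {}"
    then obtain c where c: "c \<in> C" by blast
    have "\<forall>\<alpha>\<in>C. eventually (\<lambda>n. w n \<noteq> \<alpha>) sequentially" by (simp add: C_def eventually_sequentially)
    then have "eventually (\<lambda>n. \<forall>\<alpha>\<in>C. w n \<noteq> \<alpha>) sequentially" by (simp add: eventually_ball_finite_distrib)
    then obtain N where N: "\<And>n. n \<ge> N \<Longrightarrow> w n \<notin> C" by (auto simp: eventually_sequentially)
    have const: "\<zeta> n \<alpha> = \<zeta> N \<alpha>" if "n \<ge> N" "\<alpha> \<in> C" for n \<alpha>
      using that(1)
    proof (induction n rule: dec_induct)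
      case (step n)
      then show ?case using N[of n] that(2) by (auto simp: \<zeta>_step)
    qed simp
    \<comment> \<open>\<open>1\<close> only keeps the set non-empty when all the sums vanish.\<close>
    define E where "E = insert 1 ((\<lambda>X. \<bar>\<Sum>\<alpha>\<in>X. Im (\<zeta> N \<alpha>)\<bar>) ` Pow C - {0})"
    define \<epsilon> where "\<epsilon> = Min E"
    have fin: "finite E" by (simp add: E_def)
    have \<epsilon>: "0 < \<epsilon>" unfolding \<epsilon>_def by (subst Min_gr_iff) (auto simp: fin E_def)
    have "\<forall>\<beta>\<in>-C. eventually (\<lambda>n. H n \<beta> < \<epsilon>) sequentially"
    proof
      fix \<beta> assume "\<beta> \<in> -C"
      then have "\<exists>n\<ge>M. w n = \<beta>" for M by (auto simp: C_def)
      then show "eventually (\<lambda>n. H n \<beta> < \<epsilon>) sequentially"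
        using frequent_winner_vanishes[where H = H and w = w and l = l, OF H_pos H_step _ \<epsilon>]
        by (auto simp: eventually_sequentially)
    qed
    then have "eventually (\<lambda>n. \<forall>\<beta>\<in>-C. H n \<beta> < \<epsilon>) sequentially"
      by (simp add: eventually_ball_finite_distrib)
    then obtain M where M: "\<And>n \<beta>. n \<ge> M \<Longrightarrow> \<beta> \<notin> C \<Longrightarrow> H n \<beta> < \<epsilon>"
      by (auto simp: eventually_sequentially)
    define n where "n = max N M"
    have n: "n \<ge> N" "n \<ge> M" by (simp_all add: n_def)
    have gap: "(\<Sum>\<alpha>\<in>X. Im (\<zeta> n \<alpha>)) = 0 \<or> \<epsilon> \<le> \<bar>\<Sum>\<alpha>\<in>X. Im (\<zeta> n \<alpha>)\<bar>" if "X \<subseteq> C" for X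
    proof -
      have "(\<Sum>\<alpha>\<in>X. Im (\<zeta> n \<alpha>)) = (\<Sum>\<alpha>\<in>X. Im (\<zeta> N \<alpha>))"
        by (rule sum.cong) (use const[OF n(1)] that in auto)
      moreover have "\<epsilon> \<le> \<bar>\<Sum>\<alpha>\<in>X. Im (\<zeta> N \<alpha>)\<bar>" if "(\<Sum>\<alpha>\<in>X. Im (\<zeta> N \<alpha>)) \<noteq> 0"
        unfolding \<epsilon>_def by (rule Min_le[OF fin]) (use that \<open>X \<subseteq> C\<close> in \<open>auto simp: E_def\<close>)
      ultimately show ?thesis by auto
    qed
    have "has_horizontal_connection (p n) (q n) (\<zeta> n)"
    proof (rule small_heights_connection_winner[OF susp _ \<epsilon> c N[OF n(1)] gap])
      show "Im (\<Sum>\<alpha>\<in>UNIV. \<zeta> n \<alpha>) < 0 \<and> p n (w n) = CARD('a) \<or>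
        Im (\<Sum>\<alpha>\<in>UNIV. \<zeta> n \<alpha>) > 0 \<and> q n (w n) = CARD('a)" using step[OF good] by blast
      show "height (p n) (q n) (\<zeta> n) \<beta> < \<epsilon>" if "\<beta> \<notin> C" for \<beta>
        using M[OF n(2) that] by (simp add: H_def)
    qed
    then show False using nc by blast
  qed
  then have "\<exists>n\<ge>N. winner (\<gamma> n) = \<alpha>" for \<alpha> N by (auto simp: C_def w_def)
  then have "infinitely_complete \<gamma>" by (rule infinitely_completeI)
  moreover have "backward_rotation_number \<pi>t \<pi>b (zeta lam \<tau>) \<gamma>"
    unfolding backward_rotation_number_def using S_0 step[OF good] by (intro exI[of _ S]) blast
  ultimately show ?thesis by blast
qed

end
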